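(* Suppose $\mathcal{A}$ is a $2$-category that admits tensors by $\mathbb{2}$, let $I$ be a $2$-category, and let $F\colon I\to\mathcal{A}$ be a $2$-functor. Then an object $(L,\lambda\colon\Delta L\Rightarrow F)$ is a $2$-terminal object in the strict-slice $\Delta\downarrow_s F$ of $2$-cones over $F$ if and only if it is a $2$-limit of $F$.
   Context: $\mathbb{2}$ is the category $\{0\to1\}$. A $2$-category $\mathcal{A}$ admits tensors by a category $\mathcal{C}$ if for each $X\in\mathcal{A}$ there is an object $X\otimes\mathcal{C}\in\mathcal{A}$ together with isomorphisms of categories $\mathcal{A}(X\otimes\mathcal{C},Y)\cong\mathsf{Cat}(\mathcal{C},\mathcal{A}(X,Y))$, $2$-natural in $X,Y\in\mathcal{A}$ (the right-hand side being the category of functors and natural transformations). $2$-categories and $2$-functors are strict; $*$ denotes horizontal composition (and whiskering) of $2$-morphisms. A $2$-natural transformation $\mu\colon F\Rightarrow G$ between $2$-functors $F,G\colon I\to\mathcal{A}$ consists of morphisms $\mu_i\colon Fi\to Gi$ with $(Gf)\mu_i=\mu_j(Ff)$ for every $f\colon i\to j$ in $I$ and $G\alpha*\mu_i=\mu_j*F\alpha$ for every $2$-morphism $\alpha\colon f\Rightarrow g$ in $I$. A modification $\varphi\colon\mu\to\nu$ consists of $2$-morphisms $\varphi_i\colon\mu_i\Rightarrow\nu_i$ with $Gf*\varphi_i=\varphi_j*Ff$ for every $f\colon i\to j$. $[I,\mathcal{A}]$ is the $2$-category of $2$-functors, $2$-natural transformations and modifications; $\Delta X$ is the constant $2$-functor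 at $X$; a $2$-cone over $F$ is a $2$-natural transformation $\Delta X\Rightarrow F$. A $2$-limit of $F$ is a pair $(L,\lambda\colon\Delta L\Rightarrow F)$ with $\lambda$ a $2$-cone such that for each $X\in\mathcal{A}$ the functor $\lambda_*\circ\Delta\colon\mathcal{A}(X,L)\to[I,\mathcal{A}](\Delta X,F)$, given by post-composition with $\lambda$, is an isomorphism of categories. The strict-slice $\Delta\downarrow_s F$ is the $2$-category whose objects are pairs $(X,\mu)$ with $\mu\colon\Delta X\Rightarrow F$ a $2$-cone; morphisms $(X,\mu)\to(Y,\nu)$ are morphisms $f\colon X\to Y$ of $\mathcal{A}$ with $\nu\Delta f=\mu$; $2$-morphisms $f\Rightarrow g$ are $2$-morphisms $\alpha\colon f\Rightarrow g$ of $\mathcal{A}$ with $\nu*\Delta\alpha=\mathrm{id}_\mu$. An object $L$ of a $2$-category $\mathcal{B}$ is $2$-terminal if for all $X\in\mathcal{B}$ the category $\mathcal{B}(X,L)$ is isomorphic to the terminal category $\mathbb{1}$. *)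

theory Defs
  imports "HOL-Library.FuncSet"
begin

text \<open>
  Categories and 2-categories have explicit carriers.  Everything that acts on a carrier (functors,
  transformations, modifications) is a function that is extensional on it, i.e. \<^const>\<open>undefined\<close>
  outside, so that HOL equality is the mathematical equality and functor categories really have
  functors and transformations as their elements.
\<close>


section \<open>Categories\<close>

record ('a, 'f) cat =
  ob :: "'a set"
  ar :: "'f set"
  adom :: "'f \<Rightarrow> 'a"
  acod :: "'f \<Rightarrow> 'a"
  aid :: "'a \<Rightarrow> 'f"
  acomp :: "'f \<Rightarrow> 'f \<Rightarrow> 'f"  \<comment> \<open>\<open>acomp C g f\<close> is \<open>g\<close> after \<open>f\<close>\<close>

locale category =
  fixes C :: "('a, 'f) cat"
  assumes adom_in: "f \<in> ar C \<Longrightarrow> adom C f \<in> ob C"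
    and acod_in: "f \<in> ar C \<Longrightarrow> acod C f \<in> ob C"
    and aid_in: "x \<in> ob C \<Longrightarrow> aid C x \<in> ar C"
    and adom_aid: "x \<in> ob C \<Longrightarrow> adom C (aid C x) = x"
    and acod_aid: "x \<in> ob C \<Longrightarrow> acod C (aid C x) = x"
    and acomp_in: "\<lbrakk>f \<in> ar C; g \<in> ar C; adom C g = acod C f\<rbrakk> \<Longrightarrow> acomp C g f \<in> ar C"
    and adom_acomp: "\<lbrakk>f \<in> ar C; g \<in> ar C; adom C g = acod C f\<rbrakk> \<Longrightarrow> adom C (acomp C g f) = adom C f"
    and acod_acomp: "\<lbrakk>f \<in> ar C; g \<in> ar C; adom C g = acod C f\<rbrakk> \<Longrightarrow> acod C (acomp C g f) = acod C g"
    and acomp_assoc: "\<lbrakk>f \<in> ar C; g \<in> ar C; h \<in> ar C; adom C g = acod C f; adom C h = acod C g\<rbrakk>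
      \<Longrightarrow> acomp C (acomp C h g) f = acomp C h (acomp C g f)"
    and acomp_aid_right: "f \<in> ar C \<Longrightarrow> acomp C f (aid C (adom C f)) = f"
    and acomp_aid_left: "f \<in> ar C \<Longrightarrow> acomp C (aid C (acod C f)) f = f"

text \<open>The category \<open>\<two>\<close>, as the two-element order \<open>False \<le> True\<close>.\<close>

definition cat_two :: "(bool, bool \<times> bool) cat" where
  "cat_two = \<lparr>ob = UNIV, ar = {(x, y). x \<le> y}, adom = fst, acod = snd,
     aid = (\<lambda>x. (x, x)), acomp = (\<lambda>g f. (fst f, snd g))\<rparr>"

definition cat_one :: "(unit, unit) cat" where
  "cat_one = \<lparr>ob = UNIV, ar = UNIV, adom = (\<lambda>_. ()), acod = (\<lambda>_. ()),
     aid = (\<lambda>_. ()), acomp = (\<lambda>_ _. ())\<rparr>"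

datatype ('a, 'f, 'b, 'g) fctr = Fctr (fo: "'a \<Rightarrow> 'b") (fa: "'f \<Rightarrow> 'g")

definition is_functor :: "('a, 'f) cat \<Rightarrow> ('b, 'g) cat \<Rightarrow> ('a, 'f, 'b, 'g) fctr \<Rightarrow> bool" where
  "is_functor C D F \<longleftrightarrow>
     fo F \<in> ob C \<rightarrow>\<^sub>E ob D \<and> fa F \<in> ar C \<rightarrow>\<^sub>E ar D \<and>
     (\<forall>f\<in>ar C. adom D (fa F f) = fo F (adom C f) \<and> acod D (fa F f) = fo F (acod C f)) \<and>
     (\<forall>x\<in>ob C. fa F (aid C x) = aid D (fo F x)) \<and>
     (\<forall>f\<in>ar C. \<forall>g\<in>ar C. adom C g = acod C f \<longrightarrow>
        fa F (acomp C g f) = acomp D (fa F g) (fa F f))"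

definition functor_id :: "('a, 'f) cat \<Rightarrow> ('a, 'f, 'a, 'f) fctr" where
  "functor_id C = Fctr (\<lambda>x\<in>ob C. x) (\<lambda>f\<in>ar C. f)"

text \<open>\<open>functor_comp C G F\<close> is \<open>G\<close> after \<open>F\<close>, where \<open>C\<close> is the domain of \<open>F\<close>.\<close>

definition functor_comp ::
  "('a, 'f) cat \<Rightarrow> ('b, 'g, 'c, 'h) fctr \<Rightarrow> ('a, 'f, 'b, 'g) fctr \<Rightarrow> ('a, 'f, 'c, 'h) fctr" where
  "functor_comp C G F = Fctr (\<lambda>x\<in>ob C. fo G (fo F x)) (\<lambda>f\<in>ar C. fa G (fa F f))"

definition is_cat_iso :: "('a, 'f) cat \<Rightarrow> ('b, 'g) cat \<Rightarrow> ('a, 'f, 'b, 'g) fctr \<Rightarrow> bool" where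
  "is_cat_iso C D \<Phi> \<longleftrightarrow> is_functor C D \<Phi> \<and>
     (\<exists>\<Psi>. is_functor D C \<Psi> \<and> functor_comp C \<Psi> \<Phi> = functor_id C \<and> functor_comp D \<Phi> \<Psi> = functor_id D)"

definition cat_isomorphic :: "('a, 'f) cat \<Rightarrow> ('b, 'g) cat \<Rightarrow> bool" where
  "cat_isomorphic C D \<longleftrightarrow> (\<exists>\<Phi>. is_cat_iso C D \<Phi>)"

text \<open>
  Data together with its source and target.  It is used for natural transformations, 2-natural
  transformations, modifications and the 1- and 2-morphisms of the strict-slice, whose underlying
  data does not determine source and target.
\<close>

datatype ('d, 'x) framed = Framed (source: 'd) (body: 'x) (target: 'd)

type_synonym ('a, 'f, 'b, 'g) ntrans = "(('a, 'f, 'b, 'g) fctr, 'a \<Rightarrow> 'g) framed"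

definition is_nat :: "('a, 'f) cat \<Rightarrow> ('b, 'g) cat \<Rightarrow> ('a, 'f, 'b, 'g) ntrans \<Rightarrow> bool" where
  "is_nat C D \<sigma> \<longleftrightarrow>
     is_functor C D (source \<sigma>) \<and> is_functor C D (target \<sigma>) \<and>
     body \<sigma> \<in> ob C \<rightarrow>\<^sub>E ar D \<and>
     (\<forall>x\<in>ob C. adom D (body \<sigma> x) = fo (source \<sigma>) x \<and> acod D (body \<sigma> x) = fo (target \<sigma>) x) \<and>
     (\<forall>f\<in>ar C. acomp D (fa (target \<sigma>) f) (body \<sigma> (adom C f)) =
                acomp D (body \<sigma> (acod C f)) (fa (source \<sigma>) f))"

definition functor_cat ::
  "('a, 'f) cat \<Rightarrow> ('b, 'g) cat \<Rightarrow> (('a, 'f, 'b, 'g) fctr, ('a, 'f, 'b, 'g) ntrans) cat" where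
  "functor_cat C D = \<lparr>ob = {F. is_functor C D F}, ar = {\<sigma>. is_nat C D \<sigma>},
     adom = source, acod = target,
     aid = (\<lambda>F. Framed F (\<lambda>x\<in>ob C. aid D (fo F x)) F),
     acomp = (\<lambda>\<tau> \<sigma>. Framed (source \<sigma>) (\<lambda>x\<in>ob C. acomp D (body \<tau> x) (body \<sigma> x)) (target \<tau>))\<rparr>"

text \<open>The whiskerings \<open>H\<sigma>\<close> and \<open>\<tau>K\<close>; \<open>C\<close> is the domain of \<open>\<sigma>\<close> respectively of \<open>K\<close>.\<close>

definition whisker_functor_nat ::
  "('a, 'f) cat \<Rightarrow> ('b, 'g, 'c, 'h) fctr \<Rightarrow> ('a, 'f, 'b, 'g) ntrans \<Rightarrow> ('a, 'f, 'c, 'h) ntrans" where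
  "whisker_functor_nat C H \<sigma> =
     Framed (functor_comp C H (source \<sigma>)) (\<lambda>x\<in>ob C. fa H (body \<sigma> x)) (functor_comp C H (target \<sigma>))"

definition whisker_nat_functor ::
  "('a, 'f) cat \<Rightarrow> ('b, 'g, 'c, 'h) ntrans \<Rightarrow> ('a, 'f, 'b, 'g) fctr \<Rightarrow> ('a, 'f, 'c, 'h) ntrans" where
  "whisker_nat_functor C \<tau> K =
     Framed (functor_comp C (source \<tau>) K) (\<lambda>x\<in>ob C. body \<tau> (fo K x)) (functor_comp C (target \<tau>) K)"

text \<open>
  The action of the 2-functor \<open>Cat(C, -)\<close> on a functor \<open>H\<close> with domain \<open>D\<close> and on a natural
  transformation \<open>\<tau>\<close> between functors with domain \<open>D\<close>.
\<close>

definition Cat_functor ::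
  "('a, 'f) cat \<Rightarrow> ('b, 'g) cat \<Rightarrow> ('b, 'g, 'c, 'h) fctr \<Rightarrow>
   (('a, 'f, 'b, 'g) fctr, ('a, 'f, 'b, 'g) ntrans, ('a, 'f, 'c, 'h) fctr, ('a, 'f, 'c, 'h) ntrans) fctr" where
  "Cat_functor C D H =
     Fctr (\<lambda>K\<in>ob (functor_cat C D). functor_comp C H K)
          (\<lambda>\<sigma>\<in>ar (functor_cat C D). whisker_functor_nat C H \<sigma>)"

definition Cat_nat ::
  "('a, 'f) cat \<Rightarrow> ('b, 'g) cat \<Rightarrow> ('b, 'g, 'c, 'h) ntrans \<Rightarrow>
   (('a, 'f, 'b, 'g) fctr, ('a, 'f, 'b, 'g) ntrans, ('a, 'f, 'c, 'h) fctr, ('a, 'f, 'c, 'h) ntrans) ntrans" where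
  "Cat_nat C D \<tau> =
     Framed (Cat_functor C D (source \<tau>))
            (\<lambda>K\<in>ob (functor_cat C D). whisker_nat_functor C \<tau> K)
            (Cat_functor C D (target \<tau>))"


section \<open>2-categories and 2-functors\<close>

record ('o, 'm, 't) two_cat =
  obj :: "'o set"
  mor :: "'m set"
  tmor :: "'t set"
  mdom :: "'m \<Rightarrow> 'o"
  mcod :: "'m \<Rightarrow> 'o"
  tsrc :: "'t \<Rightarrow> 'm"
  ttgt :: "'t \<Rightarrow> 'm"
  mid :: "'o \<Rightarrow> 'm"
  tid :: "'m \<Rightarrow> 't"
  mcomp :: "'m \<Rightarrow> 'm \<Rightarrow> 'm"  \<comment> \<open>\<open>g \<circ> f\<close>\<close>
  vcomp :: "'t \<Rightarrow> 't \<Rightarrow> 't"  \<comment> \<open>vertical composite, \<open>\<beta>\<close> after \<open>\<alpha>\<close>\<close>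
  hcomp :: "'t \<Rightarrow> 't \<Rightarrow> 't"  \<comment> \<open>horizontal composite \<open>\<beta> * \<alpha>\<close>, for \<open>\<alpha>\<close> in \<open>A(X,Y)\<close> and \<open>\<beta>\<close> in \<open>A(Y,Z)\<close>\<close>

definition hom :: "('o, 'm, 't) two_cat \<Rightarrow> 'o \<Rightarrow> 'o \<Rightarrow> ('m, 't) cat" where
  "hom A X Y = \<lparr>ob = {f \<in> mor A. mdom A f = X \<and> mcod A f = Y},
     ar = {\<alpha> \<in> tmor A. mdom A (tsrc A \<alpha>) = X \<and> mcod A (tsrc A \<alpha>) = Y},
     adom = tsrc A, acod = ttgt A, aid = tid A, acomp = vcomp A\<rparr>"

locale two_category =
  fixes A :: "('o, 'm, 't) two_cat"
  assumes mdom_in: "f \<in> mor A \<Longrightarrow> mdom A f \<in> obj A"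
    and mcod_in: "f \<in> mor A \<Longrightarrow> mcod A f \<in> obj A"
    and mid_in: "X \<in> obj A \<Longrightarrow> mid A X \<in> mor A"
    and mdom_mid: "X \<in> obj A \<Longrightarrow> mdom A (mid A X) = X"
    and mcod_mid: "X \<in> obj A \<Longrightarrow> mcod A (mid A X) = X"
    and mcomp_in: "\<lbrakk>f \<in> mor A; g \<in> mor A; mdom A g = mcod A f\<rbrakk> \<Longrightarrow> mcomp A g f \<in> mor A"
    and mdom_mcomp: "\<lbrakk>f \<in> mor A; g \<in> mor A; mdom A g = mcod A f\<rbrakk> \<Longrightarrow> mdom A (mcomp A g f) = mdom A f"
    and mcod_mcomp: "\<lbrakk>f \<in> mor A; g \<in> mor A; mdom A g = mcod A f\<rbrakk> \<Longrightarrow> mcod A (mcomp A g f) = mcod A g"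
    and mcomp_assoc: "\<lbrakk>f \<in> mor A; g \<in> mor A; h \<in> mor A; mdom A g = mcod A f; mdom A h = mcod A g\<rbrakk>
      \<Longrightarrow> mcomp A (mcomp A h g) f = mcomp A h (mcomp A g f)"
    and mcomp_mid_right: "f \<in> mor A \<Longrightarrow> mcomp A f (mid A (mdom A f)) = f"
    and mcomp_mid_left: "f \<in> mor A \<Longrightarrow> mcomp A (mid A (mcod A f)) f = f"
    and tsrc_in: "\<alpha> \<in> tmor A \<Longrightarrow> tsrc A \<alpha> \<in> mor A"
    and ttgt_in: "\<alpha> \<in> tmor A \<Longrightarrow> ttgt A \<alpha> \<in> mor A"
    and mdom_ttgt: "\<alpha> \<in> tmor A \<Longrightarrow> mdom A (ttgt A \<alpha>) = mdom A (tsrc A \<alpha>)"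
    and mcod_ttgt: "\<alpha> \<in> tmor A \<Longrightarrow> mcod A (ttgt A \<alpha>) = mcod A (tsrc A \<alpha>)"
    and hom_category: "\<lbrakk>X \<in> obj A; Y \<in> obj A\<rbrakk> \<Longrightarrow> category (hom A X Y)"
    and hcomp_in: "\<lbrakk>\<alpha> \<in> tmor A; \<beta> \<in> tmor A; mdom A (tsrc A \<beta>) = mcod A (tsrc A \<alpha>)\<rbrakk>
      \<Longrightarrow> hcomp A \<beta> \<alpha> \<in> tmor A"
    and tsrc_hcomp: "\<lbrakk>\<alpha> \<in> tmor A; \<beta> \<in> tmor A; mdom A (tsrc A \<beta>) = mcod A (tsrc A \<alpha>)\<rbrakk>
      \<Longrightarrow> tsrc A (hcomp A \<beta> \<alpha>) = mcomp A (tsrc A \<beta>) (tsrc A \<alpha>)"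
    and ttgt_hcomp: "\<lbrakk>\<alpha> \<in> tmor A; \<beta> \<in> tmor A; mdom A (tsrc A \<beta>) = mcod A (tsrc A \<alpha>)\<rbrakk>
      \<Longrightarrow> ttgt A (hcomp A \<beta> \<alpha>) = mcomp A (ttgt A \<beta>) (ttgt A \<alpha>)"
    and hcomp_tid: "\<lbrakk>f \<in> mor A; g \<in> mor A; mdom A g = mcod A f\<rbrakk>
      \<Longrightarrow> hcomp A (tid A g) (tid A f) = tid A (mcomp A g f)"
    and interchange: "\<lbrakk>\<alpha> \<in> tmor A; \<alpha>' \<in> tmor A; \<beta> \<in> tmor A; \<beta>' \<in> tmor A;
        tsrc A \<alpha>' = ttgt A \<alpha>; tsrc A \<beta>' = ttgt A \<beta>; mdom A (tsrc A \<beta>) = mcod A (tsrc A \<alpha>)\<rbrakk>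
      \<Longrightarrow> hcomp A (vcomp A \<beta>' \<beta>) (vcomp A \<alpha>' \<alpha>) = vcomp A (hcomp A \<beta>' \<alpha>') (hcomp A \<beta> \<alpha>)"
    and hcomp_assoc: "\<lbrakk>\<alpha> \<in> tmor A; \<beta> \<in> tmor A; \<gamma> \<in> tmor A;
        mdom A (tsrc A \<beta>) = mcod A (tsrc A \<alpha>); mdom A (tsrc A \<gamma>) = mcod A (tsrc A \<beta>)\<rbrakk>
      \<Longrightarrow> hcomp A (hcomp A \<gamma> \<beta>) \<alpha> = hcomp A \<gamma> (hcomp A \<beta> \<alpha>)"
    and hcomp_mid_right: "\<alpha> \<in> tmor A \<Longrightarrow> hcomp A \<alpha> (tid A (mid A (mdom A (tsrc A \<alpha>)))) = \<alpha>"
    and hcomp_mid_left: "\<alpha> \<in> tmor A \<Longrightarrow> hcomp A (tid A (mid A (mcod A (tsrc A \<alpha>)))) \<alpha> = \<alpha>"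

datatype ('o, 'm, 't, 'p, 'n, 'u) two_fctr =
  Two_Fctr (F0: "'o \<Rightarrow> 'p") (F1: "'m \<Rightarrow> 'n") (F2: "'t \<Rightarrow> 'u")

definition is_two_functor ::
  "('o, 'm, 't) two_cat \<Rightarrow> ('p, 'n, 'u) two_cat \<Rightarrow> ('o, 'm, 't, 'p, 'n, 'u) two_fctr \<Rightarrow> bool" where
  "is_two_functor A B F \<longleftrightarrow>
     F0 F \<in> obj A \<rightarrow>\<^sub>E obj B \<and> F1 F \<in> mor A \<rightarrow>\<^sub>E mor B \<and> F2 F \<in> tmor A \<rightarrow>\<^sub>E tmor B \<and>
     (\<forall>f\<in>mor A. mdom B (F1 F f) = F0 F (mdom A f) \<and> mcod B (F1 F f) = F0 F (mcod A f)) \<and>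
     (\<forall>\<alpha>\<in>tmor A. tsrc B (F2 F \<alpha>) = F1 F (tsrc A \<alpha>) \<and> ttgt B (F2 F \<alpha>) = F1 F (ttgt A \<alpha>)) \<and>
     (\<forall>X\<in>obj A. F1 F (mid A X) = mid B (F0 F X)) \<and>
     (\<forall>f\<in>mor A. F2 F (tid A f) = tid B (F1 F f)) \<and>
     (\<forall>f\<in>mor A. \<forall>g\<in>mor A. mdom A g = mcod A f \<longrightarrow>
        F1 F (mcomp A g f) = mcomp B (F1 F g) (F1 F f)) \<and>
     (\<forall>\<alpha>\<in>tmor A. \<forall>\<beta>\<in>tmor A. tsrc A \<beta> = ttgt A \<alpha> \<longrightarrow>
        F2 F (vcomp A \<beta> \<alpha>) = vcomp B (F2 F \<beta>) (F2 F \<alpha>)) \<and>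
     (\<forall>\<alpha>\<in>tmor A. \<forall>\<beta>\<in>tmor A. mdom A (tsrc A \<beta>) = mcod A (tsrc A \<alpha>) \<longrightarrow>
        F2 F (hcomp A \<beta> \<alpha>) = hcomp B (F2 F \<beta>) (F2 F \<alpha>))"

text \<open>The functor \<open>A(X,Y) \<rightarrow> B(FX,FY)\<close> given by a 2-functor \<open>F\<close>.\<close>

definition two_functor_on_hom ::
  "('o, 'm, 't) two_cat \<Rightarrow> ('o, 'm, 't, 'p, 'n, 'u) two_fctr \<Rightarrow> 'o \<Rightarrow> 'o \<Rightarrow> ('m, 't, 'n, 'u) fctr" where
  "two_functor_on_hom A F X Y = Fctr (\<lambda>f\<in>ob (hom A X Y). F1 F f) (\<lambda>\<alpha>\<in>ar (hom A X Y). F2 F \<alpha>)"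

text \<open>
  The 2-functor \<open>A(-,-)\<close> from \<open>A\<^sup>o\<^sup>p \<times> A\<close> to \<open>Cat\<close>: for \<open>f: X' \<rightarrow> X\<close> and \<open>g: Y \<rightarrow> Y'\<close>, the functor
  \<open>A(f,g): A(X,Y) \<rightarrow> A(X',Y')\<close> sends \<open>h\<close> to \<open>g h f\<close>, and for \<open>\<alpha>: f \<Rightarrow> f'\<close> and \<open>\<beta>: g \<Rightarrow> g'\<close> the natural
  transformation \<open>A(\<alpha>,\<beta>): A(f,g) \<Rightarrow> A(f',g')\<close> has the component \<open>\<beta> * h * \<alpha>\<close> at \<open>h\<close>.
\<close>

definition hom_functor :: "('o, 'm, 't) two_cat \<Rightarrow> 'm \<Rightarrow> 'm \<Rightarrow> ('m, 't, 'm, 't) fctr" where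
  "hom_functor A f g =
     Fctr (\<lambda>h\<in>ob (hom A (mcod A f) (mdom A g)). mcomp A g (mcomp A h f))
          (\<lambda>\<theta>\<in>ar (hom A (mcod A f) (mdom A g)). hcomp A (tid A g) (hcomp A \<theta> (tid A f)))"

definition hom_nat :: "('o, 'm, 't) two_cat \<Rightarrow> 't \<Rightarrow> 't \<Rightarrow> ('m, 't, 'm, 't) ntrans" where
  "hom_nat A \<alpha> \<beta> =
     Framed (hom_functor A (tsrc A \<alpha>) (tsrc A \<beta>))
            (\<lambda>h\<in>ob (hom A (mcod A (tsrc A \<alpha>)) (mdom A (tsrc A \<beta>))). hcomp A \<beta> (hcomp A (tid A h) \<alpha>))
            (hom_functor A (ttgt A \<alpha>) (ttgt A \<beta>))"


section \<open>Tensors\<close>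

text \<open>
  2-naturality of \<open>\<phi> X Y: A(TX,Y) \<rightarrow> Cat(C,A(X,Y))\<close> in \<open>X\<close> and \<open>Y\<close>: both sides are 2-functors from
  \<open>A\<^sup>o\<^sup>p \<times> A\<close> to \<open>Cat\<close>, and the two clauses are compatibility with 1-morphisms
  \<open>(f: X' \<rightarrow> X, g: Y \<rightarrow> Y')\<close> and with 2-morphisms \<open>(\<alpha>, \<beta>)\<close>.
\<close>

definition tensor_two_natural ::
  "('o, 'm, 't) two_cat \<Rightarrow> ('a, 'f) cat \<Rightarrow> ('o, 'm, 't, 'o, 'm, 't) two_fctr \<Rightarrow>
   ('o \<Rightarrow> 'o \<Rightarrow> ('m, 't, ('a, 'f, 'm, 't) fctr, ('a, 'f, 'm, 't) ntrans) fctr) \<Rightarrow> bool" where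
  "tensor_two_natural A C T \<phi> \<longleftrightarrow>
     (\<forall>f\<in>mor A. \<forall>g\<in>mor A.
        let X = mcod A f; X' = mdom A f; Y = mdom A g; Y' = mcod A g in
        functor_comp (hom A (F0 T X) Y) (Cat_functor C (hom A X Y) (hom_functor A f g)) (\<phi> X Y) =
        functor_comp (hom A (F0 T X) Y) (\<phi> X' Y') (hom_functor A (F1 T f) g)) \<and>
     (\<forall>\<alpha>\<in>tmor A. \<forall>\<beta>\<in>tmor A.
        let X = mcod A (tsrc A \<alpha>); X' = mdom A (tsrc A \<alpha>);
            Y = mdom A (tsrc A \<beta>); Y' = mcod A (tsrc A \<beta>) in
        whisker_nat_functor (hom A (F0 T X) Y) (Cat_nat C (hom A X Y) (hom_nat A \<alpha> \<beta>)) (\<phi> X Y) =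
        whisker_functor_nat (hom A (F0 T X) Y) (\<phi> X' Y') (hom_nat A (F2 T \<alpha>) \<beta>))"

text \<open>
  2-naturality in \<open>X\<close> presupposes that \<open>X \<mapsto> X \<otimes> C\<close> is a 2-functor \<open>T\<close>.
\<close>

definition admits_tensors :: "('o, 'm, 't) two_cat \<Rightarrow> ('a, 'f) cat \<Rightarrow> bool" where
  "admits_tensors A C \<longleftrightarrow>
     (\<exists>T \<phi>. is_two_functor A A T \<and>
        (\<forall>X\<in>obj A. \<forall>Y\<in>obj A. is_cat_iso (hom A (F0 T X) Y) (functor_cat C (hom A X Y)) (\<phi> X Y)) \<and>
        tensor_two_natural A C T \<phi>)"


section \<open>The 2-category \<open>[I,A]\<close>\<close>

type_synonym ('i, 'j, 'k, 'o, 'm, 't) two_ntrans =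
  "(('i, 'j, 'k, 'o, 'm, 't) two_fctr, 'i \<Rightarrow> 'm) framed"

type_synonym ('i, 'j, 'k, 'o, 'm, 't) modif =
  "(('i, 'j, 'k, 'o, 'm, 't) two_ntrans, 'i \<Rightarrow> 't) framed"

definition is_two_natural ::
  "('i, 'j, 'k) two_cat \<Rightarrow> ('o, 'm, 't) two_cat \<Rightarrow> ('i, 'j, 'k, 'o, 'm, 't) two_ntrans \<Rightarrow> bool" where
  "is_two_natural I A \<mu> \<longleftrightarrow>
     is_two_functor I A (source \<mu>) \<and> is_two_functor I A (target \<mu>) \<and>
     body \<mu> \<in> (\<Pi>\<^sub>E i\<in>obj I. ob (hom A (F0 (source \<mu>) i) (F0 (target \<mu>) i))) \<and>
     (\<forall>f\<in>mor I. mcomp A (F1 (target \<mu>) f) (body \<mu> (mdom I f)) =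
                 mcomp A (body \<mu> (mcod I f)) (F1 (source \<mu>) f)) \<and>
     (\<forall>\<alpha>\<in>tmor I. hcomp A (F2 (target \<mu>) \<alpha>) (tid A (body \<mu> (mdom I (tsrc I \<alpha>)))) =
                  hcomp A (tid A (body \<mu> (mcod I (tsrc I \<alpha>)))) (F2 (source \<mu>) \<alpha>))"

definition is_modification ::
  "('i, 'j, 'k) two_cat \<Rightarrow> ('o, 'm, 't) two_cat \<Rightarrow> ('i, 'j, 'k, 'o, 'm, 't) modif \<Rightarrow> bool" where
  "is_modification I A \<phi> \<longleftrightarrow>
     is_two_natural I A (source \<phi>) \<and> is_two_natural I A (target \<phi>) \<and>
     source (source \<phi>) = source (target \<phi>) \<and> target (source \<phi>) = target (target \<phi>) \<and>
     body \<phi> \<in> obj I \<rightarrow>\<^sub>E tmor A \<and>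
     (\<forall>i\<in>obj I. tsrc A (body \<phi> i) = body (source \<phi>) i \<and> ttgt A (body \<phi> i) = body (target \<phi>) i) \<and>
     (\<forall>f\<in>mor I. hcomp A (tid A (F1 (target (source \<phi>)) f)) (body \<phi> (mdom I f)) =
                 hcomp A (body \<phi> (mcod I f)) (tid A (F1 (source (source \<phi>)) f)))"

definition two_nat_id ::
  "('i, 'j, 'k) two_cat \<Rightarrow> ('o, 'm, 't) two_cat \<Rightarrow>
   ('i, 'j, 'k, 'o, 'm, 't) two_fctr \<Rightarrow> ('i, 'j, 'k, 'o, 'm, 't) two_ntrans" where
  "two_nat_id I A F = Framed F (\<lambda>i\<in>obj I. mid A (F0 F i)) F"

definition two_nat_comp ::
  "('i, 'j, 'k) two_cat \<Rightarrow> ('o, 'm, 't) two_cat \<Rightarrow> ('i, 'j, 'k, 'o, 'm, 't) two_ntrans \<Rightarrow>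
   ('i, 'j, 'k, 'o, 'm, 't) two_ntrans \<Rightarrow> ('i, 'j, 'k, 'o, 'm, 't) two_ntrans" where
  "two_nat_comp I A \<nu> \<mu> =
     Framed (source \<mu>) (\<lambda>i\<in>obj I. mcomp A (body \<nu> i) (body \<mu> i)) (target \<nu>)"

definition functor_two_cat ::
  "('i, 'j, 'k) two_cat \<Rightarrow> ('o, 'm, 't) two_cat \<Rightarrow>
   (('i, 'j, 'k, 'o, 'm, 't) two_fctr, ('i, 'j, 'k, 'o, 'm, 't) two_ntrans,
    ('i, 'j, 'k, 'o, 'm, 't) modif) two_cat" where
  "functor_two_cat I A =
     \<lparr>obj = {F. is_two_functor I A F}, mor = {\<mu>. is_two_natural I A \<mu>}, tmor = {\<phi>. is_modification I A \<phi>},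
      mdom = source, mcod = target, tsrc = source, ttgt = target,
      mid = two_nat_id I A,
      tid = (\<lambda>\<mu>. Framed \<mu> (\<lambda>i\<in>obj I. tid A (body \<mu> i)) \<mu>),
      mcomp = two_nat_comp I A,
      vcomp = (\<lambda>\<psi> \<phi>. Framed (source \<phi>) (\<lambda>i\<in>obj I. vcomp A (body \<psi> i) (body \<phi> i)) (target \<psi>)),
      hcomp = (\<lambda>\<psi> \<phi>. Framed (two_nat_comp I A (source \<psi>) (source \<phi>))
                            (\<lambda>i\<in>obj I. hcomp A (body \<psi> i) (body \<phi> i))
                            (two_nat_comp I A (target \<psi>) (target \<phi>)))\<rparr>"

definition const_two_functor ::
  "('i, 'j, 'k) two_cat \<Rightarrow> ('o, 'm, 't) two_cat \<Rightarrow> 'o \<Rightarrow> ('i, 'j, 'k, 'o, 'm, 't) two_fctr" where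
  "const_two_functor I A X =
     Two_Fctr (\<lambda>i\<in>obj I. X) (\<lambda>f\<in>mor I. mid A X) (\<lambda>\<alpha>\<in>tmor I. tid A (mid A X))"

definition const_two_nat ::
  "('i, 'j, 'k) two_cat \<Rightarrow> ('o, 'm, 't) two_cat \<Rightarrow> 'm \<Rightarrow> ('i, 'j, 'k, 'o, 'm, 't) two_ntrans" where
  "const_two_nat I A f =
     Framed (const_two_functor I A (mdom A f)) (\<lambda>i\<in>obj I. f) (const_two_functor I A (mcod A f))"

definition const_modif ::
  "('i, 'j, 'k) two_cat \<Rightarrow> ('o, 'm, 't) two_cat \<Rightarrow> 't \<Rightarrow> ('i, 'j, 'k, 'o, 'm, 't) modif" where
  "const_modif I A \<alpha> =
     Framed (const_two_nat I A (tsrc A \<alpha>)) (\<lambda>i\<in>obj I. \<alpha>) (const_two_nat I A (ttgt A \<alpha>))"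

text \<open>The diagonal 2-functor \<open>\<Delta>: A \<rightarrow> [I,A]\<close>.\<close>

definition diag ::
  "('i, 'j, 'k) two_cat \<Rightarrow> ('o, 'm, 't) two_cat \<Rightarrow>
   ('o, 'm, 't, ('i, 'j, 'k, 'o, 'm, 't) two_fctr, ('i, 'j, 'k, 'o, 'm, 't) two_ntrans,
    ('i, 'j, 'k, 'o, 'm, 't) modif) two_fctr" where
  "diag I A = Two_Fctr (\<lambda>X\<in>obj A. const_two_functor I A X) (\<lambda>f\<in>mor A. const_two_nat I A f)
                       (\<lambda>\<alpha>\<in>tmor A. const_modif I A \<alpha>)"


section \<open>2-cones, 2-limits and the strict-slice\<close>

definition is_two_cone ::
  "('i, 'j, 'k) two_cat \<Rightarrow> ('o, 'm, 't) two_cat \<Rightarrow> ('i, 'j, 'k, 'o, 'm, 't) two_fctr \<Rightarrow>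
   'o \<Rightarrow> ('i, 'j, 'k, 'o, 'm, 't) two_ntrans \<Rightarrow> bool" where
  "is_two_cone I A F X \<mu> \<longleftrightarrow> X \<in> obj A \<and> \<mu> \<in> ob (hom (functor_two_cat I A) (F0 (diag I A) X) F)"

text \<open>For \<open>l: Y \<rightarrow> Z\<close> in \<open>B\<close>, the functor \<open>l\<^sub>*: B(X,Y) \<rightarrow> B(X,Z)\<close> of post-composition with \<open>l\<close>.\<close>

definition postcomp_functor :: "('o, 'm, 't) two_cat \<Rightarrow> 'o \<Rightarrow> 'm \<Rightarrow> ('m, 't, 'm, 't) fctr" where
  "postcomp_functor B X l =
     Fctr (\<lambda>h\<in>ob (hom B X (mdom B l)). mcomp B l h)
          (\<lambda>\<theta>\<in>ar (hom B X (mdom B l)). hcomp B (tid B l) \<theta>)"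

definition is_two_limit ::
  "('i, 'j, 'k) two_cat \<Rightarrow> ('o, 'm, 't) two_cat \<Rightarrow> ('i, 'j, 'k, 'o, 'm, 't) two_fctr \<Rightarrow>
   'o \<times> ('i, 'j, 'k, 'o, 'm, 't) two_ntrans \<Rightarrow> bool" where
  "is_two_limit I A F = (\<lambda>(L, l). is_two_cone I A F L l \<and>
     (\<forall>X\<in>obj A.
        is_cat_iso (hom A X L) (hom (functor_two_cat I A) (F0 (diag I A) X) F)
          (functor_comp (hom A X L)
             (postcomp_functor (functor_two_cat I A) (F0 (diag I A) X) l)
             (two_functor_on_hom A (diag I A) X L))))"

text \<open>A morphism \<open>(X,\<mu>) \<rightarrow> (Y,\<nu>)\<close> of the strict-slice is \<open>Framed (X,\<mu>) f (Y,\<nu>)\<close>.\<close>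

type_synonym ('i, 'j, 'k, 'o, 'm, 't) slice_mor =
  "('o \<times> ('i, 'j, 'k, 'o, 'm, 't) two_ntrans, 'm) framed"

definition is_slice_mor ::
  "('i, 'j, 'k) two_cat \<Rightarrow> ('o, 'm, 't) two_cat \<Rightarrow> ('i, 'j, 'k, 'o, 'm, 't) two_fctr \<Rightarrow>
   ('i, 'j, 'k, 'o, 'm, 't) slice_mor \<Rightarrow> bool" where
  "is_slice_mor I A F p \<longleftrightarrow>
     (let (X, \<mu>) = source p; f = body p; (Y, \<nu>) = target p in
        is_two_cone I A F X \<mu> \<and> is_two_cone I A F Y \<nu> \<and> f \<in> ob (hom A X Y) \<and>
        mcomp (functor_two_cat I A) \<nu> (F1 (diag I A) f) = \<mu>)"

definition is_slice_tmor ::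
  "('i, 'j, 'k) two_cat \<Rightarrow> ('o, 'm, 't) two_cat \<Rightarrow> ('i, 'j, 'k, 'o, 'm, 't) two_fctr \<Rightarrow>
   (('i, 'j, 'k, 'o, 'm, 't) slice_mor, 't) framed \<Rightarrow> bool" where
  "is_slice_tmor I A F a \<longleftrightarrow>
     (let p = source a; \<alpha> = body a; q = target a; (X, \<mu>) = source p; (Y, \<nu>) = target p in
        is_slice_mor I A F p \<and> is_slice_mor I A F q \<and> source q = (X, \<mu>) \<and> target q = (Y, \<nu>) \<and>
        \<alpha> \<in> tmor A \<and> tsrc A \<alpha> = body p \<and> ttgt A \<alpha> = body q \<and>
        hcomp (functor_two_cat I A) (tid (functor_two_cat I A) \<nu>) (F2 (diag I A) \<alpha>)
          = tid (functor_two_cat I A) \<mu>)"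

definition slice_mcomp ::
  "('o, 'm, 't) two_cat \<Rightarrow> ('i, 'j, 'k, 'o, 'm, 't) slice_mor \<Rightarrow>
   ('i, 'j, 'k, 'o, 'm, 't) slice_mor \<Rightarrow> ('i, 'j, 'k, 'o, 'm, 't) slice_mor" where
  "slice_mcomp A q p = Framed (source p) (mcomp A (body q) (body p)) (target q)"

definition strict_slice ::
  "('i, 'j, 'k) two_cat \<Rightarrow> ('o, 'm, 't) two_cat \<Rightarrow> ('i, 'j, 'k, 'o, 'm, 't) two_fctr \<Rightarrow>
   ('o \<times> ('i, 'j, 'k, 'o, 'm, 't) two_ntrans, ('i, 'j, 'k, 'o, 'm, 't) slice_mor,
    (('i, 'j, 'k, 'o, 'm, 't) slice_mor, 't) framed) two_cat" where
  "strict_slice I A F =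
     \<lparr>obj = {(X, \<mu>). is_two_cone I A F X \<mu>},
      mor = {p. is_slice_mor I A F p}, tmor = {a. is_slice_tmor I A F a},
      mdom = source, mcod = target, tsrc = source, ttgt = target,
      mid = (\<lambda>(X, \<mu>). Framed (X, \<mu>) (mid A X) (X, \<mu>)),
      tid = (\<lambda>p. Framed p (tid A (body p)) p),
      mcomp = slice_mcomp A,
      vcomp = (\<lambda>b a. Framed (source a) (vcomp A (body b) (body a)) (target b)),
      hcomp = (\<lambda>b a. Framed (slice_mcomp A (source b) (source a)) (hcomp A (body b) (body a))
                            (slice_mcomp A (target b) (target a)))\<rparr>"

definition is_two_terminal :: "('o, 'm, 't) two_cat \<Rightarrow> 'o \<Rightarrow> bool" where
  "is_two_terminal B L \<longleftrightarrow> L \<in> obj B \<and> (\<forall>X\<in>obj B. cat_isomorphic (hom B X L) cat_one)"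

end

theory Submission
  imports Defs
begin

text \<open>
  A 2-limit is 2-terminal in the strict-slice because bijectivity of post-composition on objects and
  on arrows yields exactly one morphism and one 2-morphism into it.  Conversely, let \<open>(L, l)\<close> be
  2-terminal.  The tensor of \<open>X\<close> by \<open>\<two>\<close> is an object \<open>T\<close> with a universal 2-morphism
  \<open>u: a \<Rightarrow> b: X \<rightarrow> T\<close>, so a modification between 2-cones with vertex \<open>X\<close> is the same as a single
  2-cone with vertex \<open>T\<close>: its compatibility with 1-morphisms of \<open>I\<close> follows by uniqueness of
  factorizations through \<open>u\<close>, and with 2-morphisms because whiskering with \<open>a\<close> and \<open>b\<close> is jointly
  faithful.  The factorizations of that 2-cone through \<open>l\<close> then correspond to the
  2-morphisms \<open>X \<rightarrow> L\<close> inducing the modification.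
\<close>

section \<open>Isomorphisms of categories\<close>

lemma is_functorD:
  assumes "is_functor C D F"
  shows "f \<in> ar C \<Longrightarrow> fa F f \<in> ar D"
    and "f \<in> ar C \<Longrightarrow> adom D (fa F f) = fo F (adom C f)"
    and "f \<in> ar C \<Longrightarrow> acod D (fa F f) = fo F (acod C f)"
    and "x \<in> ob C \<Longrightarrow> fo F x \<in> ob D"
    and "x \<in> ob C \<Longrightarrow> fa F (aid C x) = aid D (fo F x)"
    and "\<lbrakk>f \<in> ar C; g \<in> ar C; adom C g = acod C f\<rbrakk> \<Longrightarrow>
      fa F (acomp C g f) = acomp D (fa F g) (fa F f)"
    and "f \<notin> ar C \<Longrightarrow> fa F f = undefined"
  using assms unfolding is_functor_def by auto

lemma is_cat_iso_bij_betw: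
  assumes "is_cat_iso C D \<Phi>"
  shows "bij_betw (fo \<Phi>) (ob C) (ob D)" and "bij_betw (fa \<Phi>) (ar C) (ar D)"
proof -
  obtain \<Psi> where \<Psi>: "is_functor D C \<Psi>"
    and 1: "functor_comp C \<Psi> \<Phi> = functor_id C" and 2: "functor_comp D \<Phi> \<Psi> = functor_id D"
    and \<Phi>: "is_functor C D \<Phi>"
    using assms unfolding is_cat_iso_def by blast
  have o1: "fo \<Psi> (fo \<Phi> x) = x" if "x \<in> ob C" for x
    using arg_cong[OF 1, of "\<lambda>H. fo H x"] that by (simp add: functor_comp_def functor_id_def)
  have o2: "fo \<Phi> (fo \<Psi> x) = x" if "x \<in> ob D" for x
    using arg_cong[OF 2, of "\<lambda>H. fo H x"] that by (simp add: functor_comp_def functor_id_def)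
  have a1: "fa \<Psi> (fa \<Phi> f) = f" if "f \<in> ar C" for f
    using arg_cong[OF 1, of "\<lambda>H. fa H f"] that by (simp add: functor_comp_def functor_id_def)
  have a2: "fa \<Phi> (fa \<Psi> f) = f" if "f \<in> ar D" for f
    using arg_cong[OF 2, of "\<lambda>H. fa H f"] that by (simp add: functor_comp_def functor_id_def)
  show "bij_betw (fo \<Phi>) (ob C) (ob D)"
    using \<Phi> \<Psi> o1 o2 by (intro bij_betw_byWitness[where f' = "fo \<Psi>"]) (auto simp: is_functor_def)
  show "bij_betw (fa \<Phi>) (ar C) (ar D)"
    using \<Phi> \<Psi> a1 a2 by (intro bij_betw_byWitness[where f' = "fa \<Psi>"]) (auto simp: is_functor_def)
qed

text \<open>Inverting the two bijections gives a functor: endpoints, identities and composites in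
  \<open>D\<close> are \<Phi>-images of those in \<open>C\<close>, and the inverses cancel \<Phi>.
  Structure is only transported out of \<open>C\<close>, so the criterion applies to hom-categories
  of \<open>[I,A]\<close> without first showing that \<open>[I,A]\<close> is a 2-category.\<close>

lemma is_cat_isoI:
  assumes "category C" and \<Phi>: "is_functor C D \<Phi>"
    and o: "bij_betw (fo \<Phi>) (ob C) (ob D)" and a: "bij_betw (fa \<Phi>) (ar C) (ar D)"
  shows "is_cat_iso C D \<Phi>"
proof -
  interpret category C by fact
  define po where "po = inv_into (ob C) (fo \<Phi>)"
  define pa where "pa = inv_into (ar C) (fa \<Phi>)"
  define \<Psi> where "\<Psi> = Fctr (restrict po (ob D)) (restrict pa (ar D))"
  have o1: "po (fo \<Phi> x) = x" if "x \<in> ob C" for x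
    using o that by (simp add: po_def bij_betw_def)
  have o2: "fo \<Phi> (po y) = y" "po y \<in> ob C" if "y \<in> ob D" for y
    using o that by (simp_all add: po_def bij_betw_def f_inv_into_f inv_into_into)
  have a1: "pa (fa \<Phi> f) = f" if "f \<in> ar C" for f
    using a that by (simp add: pa_def bij_betw_def)
  have a2: "fa \<Phi> (pa g) = g" "pa g \<in> ar C" if "g \<in> ar D" for g
    using a that by (simp_all add: pa_def bij_betw_def f_inv_into_f inv_into_into)
  note \<Phi>a = is_functorD(1-3)[OF \<Phi>] and \<Phi>o = is_functorD(4)[OF \<Phi>]
    and \<Phi>id = is_functorD(5)[OF \<Phi>] and \<Phi>comp = is_functorD(6)[OF \<Phi>]
  have d: "po (adom D g) = adom C (pa g)" "po (acod D g) = acod C (pa g)"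
    "adom D g \<in> ob D" "acod D g \<in> ob D" if "g \<in> ar D" for g
    using \<Phi>a(2,3)[OF a2(2)[OF that]] a2[OF that] o1 adom_in acod_in \<Phi>o by metis+
  have i: "pa (aid D y) = aid C (po y)" "aid D y \<in> ar D" if "y \<in> ob D" for y
    using \<Phi>id[OF o2(2)[OF that]] o2[OF that] a1 aid_in \<Phi>a(1) by metis+
  have c: "pa (acomp D g f) = acomp C (pa g) (pa f)" "acomp D g f \<in> ar D"
    if "f \<in> ar D" "g \<in> ar D" "adom D g = acod D f" for f g
  proof -
    have "adom C (pa g) = acod C (pa f)" using d that by metis
    then show "pa (acomp D g f) = acomp C (pa g) (pa f)" "acomp D g f \<in> ar D"
      using \<Phi>comp[of "pa f" "pa g"] a1 a2 that acomp_in \<Phi>a(1) by metis+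
  qed
  have "is_functor D C \<Psi>"
    unfolding is_functor_def \<Psi>_def using o2 a2 d i c by auto
  moreover have "functor_comp C \<Psi> \<Phi> = functor_id C" "functor_comp D \<Phi> \<Psi> = functor_id D"
    unfolding functor_comp_def functor_id_def \<Psi>_def
    using o1 o2 a1 a2 \<Phi>o \<Phi>a(1) by (auto intro!: restrict_ext)
  ultimately show ?thesis using \<Phi> unfolding is_cat_iso_def by blast
qed

lemma cat_isomorphic_one_ob:
  assumes "cat_isomorphic C cat_one"
  shows "\<exists>!x. x \<in> ob C"
proof -
  obtain \<Phi> where "is_cat_iso C cat_one \<Phi>"
    using assms unfolding cat_isomorphic_def by blast
  then have "bij_betw (fo \<Phi>) (ob C) (ob cat_one)" by (rule is_cat_iso_bij_betw(1))
  then have "bij_betw (fo \<Phi>) (ob C) {()}" by (simp add: cat_one_def UNIV_unit)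
  then have "card (ob C) = 1" using bij_betw_same_card by fastforce
  then obtain x where "ob C = {x}" by (rule card_1_singletonE)
  then show ?thesis by simp
qed

lemma cat_isomorphic_oneI:
  assumes "ob C = {x}" "ar C = {f}" "adom C f = x" "acod C f = x" "aid C x = f" "acomp C f f = f"
  shows "cat_isomorphic C cat_one"
proof -
  have "category C" by standard (use assms in auto)
  moreover have "is_functor C cat_one (Fctr (\<lambda>_\<in>ob C. ()) (\<lambda>_\<in>ar C. ()))"
    unfolding is_functor_def by (auto simp: cat_one_def)
  ultimately have "is_cat_iso C cat_one (Fctr (\<lambda>_\<in>ob C. ()) (\<lambda>_\<in>ar C. ()))"
    by (rule is_cat_isoI) (use assms in \<open>auto simp: cat_one_def bij_betw_def\<close>)
  then show ?thesis unfolding cat_isomorphic_def by blast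
qed


section \<open>Arrow categories and tensors by \<open>\<two>\<close>\<close>

text \<open>The object values are the endpoints of the image of \<open>(False, True)\<close>, and
  all other arrows of \<open>cat_two\<close> are identities, so this one image determines the
  functor.\<close>

lemma functor_two_eqI:
  assumes "is_functor cat_two D K" "is_functor cat_two D K'"
    and eq: "fa K (False, True) = fa K' (False, True)"
  shows "K = K'"
proof -
  have two: "(False, True) \<in> ar cat_two" "adom cat_two (False, True) = False"
    "acod cat_two (False, True) = True" "x \<in> ob cat_two" "aid cat_two x = (x, x)" for x
    by (simp_all add: cat_two_def)
  have src: "fo J False = adom D (fa J (False, True))" and tgt: "fo J True = acod D (fa J (False, True))"
    and unit: "fa J (x, x) = aid D (fo J x)" if "is_functor cat_two D J" for J x
    using is_functorD(2,3)[OF that two(1)] is_functorD(5)[OF that two(4)] two by simp_all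
  have "fo K x = fo K' x" for x
    using src[OF assms(1)] src[OF assms(2)] tgt[OF assms(1)] tgt[OF assms(2)] eq by (cases x) simp_all
  then have o: "fo K = fo K'" by (rule ext)
  have "fa K f = fa K' f" for f
  proof (cases "f \<in> ar cat_two")
    case True
    then have "f = (False, True) \<or> (\<exists>x. f = (x, x))"
      by (cases f) (auto simp: cat_two_def)
    then show ?thesis using eq unit[OF assms(1)] unit[OF assms(2)] o by auto
  next
    \<comment> \<open>The only pair outside the order is \<open>(True, False)\<close>, where both
      arrow maps are \<open>undefined\<close> by extensionality.\<close>
    case False
    then show ?thesis using is_functorD(7)[OF assms(1)] is_functorD(7)[OF assms(2)] by simp
  qed
  then have "fa K = fa K'" by (rule ext)
  with o show ?thesis by (rule fctr.expand[OF conjI])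
qed

text \<open>With \<open>functor_two_eqI\<close> this makes functors out of \<open>cat_two\<close>
  the same as arrows of the target, which turns tensors by \<open>cat_two\<close> into a universal
  property for 2-morphisms.\<close>

lemma (in category) ex_functor_two:
  assumes f: "f \<in> ar C"
  shows "\<exists>K. is_functor cat_two C K \<and> fa K (False, True) = f"
proof -
  have unit: "acomp C (aid C x) (aid C x) = aid C x" if "x \<in> ob C" for x
    using acomp_aid_right[OF aid_in[OF that]] adom_aid[OF that] by simp
  note rules = adom_in[OF f] acod_in[OF f] acomp_aid_left[OF f] acomp_aid_right[OF f] unit
  define o' where "o' = (\<lambda>b. if b then acod C f else adom C f)"
  \<comment> \<open>An arrow of \<open>cat_two\<close> other than \<open>(False, True)\<close> is
    some \<open>(x, x)\<close>, so the other branch only has to supply the identity at the image of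
    \<open>x\<close>.\<close>
  define a' where "a' = (\<lambda>p\<in>ar cat_two. if p = (False, True) then f else aid C (o' (fst p)))"
  have "is_functor cat_two C (Fctr o' a')"
    unfolding is_functor_def
    by (auto simp: cat_two_def o'_def a'_def f aid_in adom_aid acod_aid rules)
  moreover have "fa (Fctr o' a') (False, True) = f" by (simp add: a'_def cat_two_def)
  ultimately show ?thesis by blast
qed

context two_category
begin

section \<open>Identities, vertical composites and whiskering in a 2-category\<close>

lemma tid_in: "f \<in> mor A \<Longrightarrow> tid A f \<in> tmor A"
  and tsrc_tid: "f \<in> mor A \<Longrightarrow> tsrc A (tid A f) = f"
  and ttgt_tid: "f \<in> mor A \<Longrightarrow> ttgt A (tid A f) = f"
  using category.aid_in[OF hom_category, of "mdom A f" "mcod A f" f]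
    category.adom_aid[OF hom_category, of "mdom A f" "mcod A f" f]
    category.acod_aid[OF hom_category, of "mdom A f" "mcod A f" f]
  by (auto simp: hom_def mdom_in mcod_in)

lemma vcomp_in:
    "\<lbrakk>\<alpha> \<in> tmor A; \<beta> \<in> tmor A; tsrc A \<beta> = ttgt A \<alpha>\<rbrakk> \<Longrightarrow> vcomp A \<beta> \<alpha> \<in> tmor A"
  and tsrc_vcomp:
    "\<lbrakk>\<alpha> \<in> tmor A; \<beta> \<in> tmor A; tsrc A \<beta> = ttgt A \<alpha>\<rbrakk> \<Longrightarrow> tsrc A (vcomp A \<beta> \<alpha>) = tsrc A \<alpha>"
  and ttgt_vcomp:
    "\<lbrakk>\<alpha> \<in> tmor A; \<beta> \<in> tmor A; tsrc A \<beta> = ttgt A \<alpha>\<rbrakk> \<Longrightarrow> ttgt A (vcomp A \<beta> \<alpha>) = ttgt A \<beta>"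
  using category.acomp_in[OF hom_category, of "mdom A (tsrc A \<alpha>)" "mcod A (tsrc A \<alpha>)" \<alpha> \<beta>]
    category.adom_acomp[OF hom_category, of "mdom A (tsrc A \<alpha>)" "mcod A (tsrc A \<alpha>)" \<alpha> \<beta>]
    category.acod_acomp[OF hom_category, of "mdom A (tsrc A \<alpha>)" "mcod A (tsrc A \<alpha>)" \<alpha> \<beta>]
  by (auto simp: hom_def mdom_in mcod_in tsrc_in mdom_ttgt mcod_ttgt)

lemma vcomp_tid_tid: "f \<in> mor A \<Longrightarrow> vcomp A (tid A f) (tid A f) = tid A f"
  using category.acomp_aid_right[OF hom_category, of "mdom A f" "mcod A f" "tid A f"]
  by (auto simp: hom_def mdom_in mcod_in tid_in tsrc_tid)

lemma tid_mid_whisker: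
  "\<lbrakk>\<alpha> \<in> tmor A; mdom A (tsrc A \<alpha>) = X\<rbrakk> \<Longrightarrow> hcomp A \<alpha> (tid A (mid A X)) = \<alpha>"
  "\<lbrakk>\<alpha> \<in> tmor A; mcod A (tsrc A \<alpha>) = X\<rbrakk> \<Longrightarrow> hcomp A (tid A (mid A X)) \<alpha> = \<alpha>"
  "\<lbrakk>f \<in> mor A; mdom A f = X\<rbrakk> \<Longrightarrow> mcomp A f (mid A X) = f"
  "\<lbrakk>f \<in> mor A; mcod A f = X\<rbrakk> \<Longrightarrow> mcomp A (mid A X) f = f"
  using hcomp_mid_right hcomp_mid_left mcomp_mid_right mcomp_mid_left by auto

lemma whisker_mcomp_left:
  "\<lbrakk>\<alpha> \<in> tmor A; g \<in> mor A; k \<in> mor A; mdom A g = mcod A (tsrc A \<alpha>); mdom A k = mcod A g\<rbrakk>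
    \<Longrightarrow> hcomp A (tid A (mcomp A k g)) \<alpha> = hcomp A (tid A k) (hcomp A (tid A g) \<alpha>)"
  by (metis hcomp_tid hcomp_assoc tid_in tsrc_tid)

text \<open>A Yoneda argument: \<open>u\<close> corresponds to the identity of \<open>T\<close>
  under \<open>A(T,T)\<close> \<cong> \<open>Cat(2, A(X,T))\<close>, and naturality in the second
  variable expresses every \<open>\<phi> X Y\<close> by whiskering with \<open>u\<close> or with its
  source and target. The last three conclusions are then surjectivity on objects, injectivity on
  objects and injectivity on arrows of \<open>\<phi> X Y\<close>.\<close>

lemma tensor_two_obtain:
  assumes "admits_tensors A cat_two" and X: "X \<in> obj A"
  obtains T u where
    "T \<in> obj A" "u \<in> tmor A" "mdom A (tsrc A u) = X" "mcod A (tsrc A u) = T"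
    "\<And>\<theta>. \<lbrakk>\<theta> \<in> tmor A; mdom A (tsrc A \<theta>) = X\<rbrakk> \<Longrightarrow>
      \<exists>k\<in>mor A. mdom A k = T \<and> mcod A k = mcod A (tsrc A \<theta>) \<and> hcomp A (tid A k) u = \<theta>"
    "\<And>k k'. \<lbrakk>k \<in> mor A; k' \<in> mor A; mdom A k = T; mdom A k' = T; mcod A k = mcod A k';
      hcomp A (tid A k) u = hcomp A (tid A k') u\<rbrakk> \<Longrightarrow> k = k'"
    "\<And>\<beta> \<beta>'. \<lbrakk>\<beta> \<in> tmor A; \<beta>' \<in> tmor A; mdom A (tsrc A \<beta>) = T; tsrc A \<beta> = tsrc A \<beta>'; ttgt A \<beta> = ttgt A \<beta>';
      hcomp A \<beta> (tid A (tsrc A u)) = hcomp A \<beta>' (tid A (tsrc A u));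
      hcomp A \<beta> (tid A (ttgt A u)) = hcomp A \<beta>' (tid A (ttgt A u))\<rbrakk> \<Longrightarrow> \<beta> = \<beta>'"
proof -
  obtain S \<phi> where S: "is_two_functor A A S"
    and iso: "\<And>X Y. \<lbrakk>X \<in> obj A; Y \<in> obj A\<rbrakk> \<Longrightarrow>
      is_cat_iso (hom A (F0 S X) Y) (functor_cat cat_two (hom A X Y)) (\<phi> X Y)"
    and nat: "tensor_two_natural A cat_two S \<phi>"
    using assms(1) unfolding admits_tensors_def by blast
  define T where "T = F0 S X"
  have T: "T \<in> obj A" using S X unfolding T_def is_two_functor_def by auto
  \<comment> \<open>Naturality is stated jointly in both variables. It will be instantiated at the
    identity of \<open>X\<close> in the first one, which \<open>S\<close> has to carry to the
    identity of \<open>T\<close>.\<close>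
  have SX: "F1 S (mid A X) = mid A T" "F2 S (tid A (mid A X)) = tid A (mid A T)"
    using S X mid_in unfolding T_def is_two_functor_def by auto
  define K where "K = fo (\<phi> X T) (mid A T)"
  define u where "u = fa K (False, True)"
  have midT: "mid A T \<in> ob (hom A T T)" using T by (simp add: hom_def mid_in mdom_mid mcod_mid)
  have bo: "bij_betw (fo (\<phi> X Y)) (ob (hom A T Y)) (ob (functor_cat cat_two (hom A X Y)))"
    and ba: "bij_betw (fa (\<phi> X Y)) (ar (hom A T Y)) (ar (functor_cat cat_two (hom A X Y)))"
    and fu: "is_functor (hom A T Y) (functor_cat cat_two (hom A X Y)) (\<phi> X Y)"
    if "Y \<in> obj A" for Y
    using is_cat_iso_bij_betw[OF iso[OF X that]] iso[OF X that]
    by (auto simp: T_def is_cat_iso_def)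
  have Kob: "K \<in> ob (functor_cat cat_two (hom A X T))"
    using bo[OF T] midT unfolding K_def bij_betw_def by blast
  then have K: "is_functor cat_two (hom A X T) K" by (simp add: functor_cat_def)
  have u: "u \<in> tmor A" "mdom A (tsrc A u) = X" "mcod A (tsrc A u) = T"
    "tsrc A u = fo K False" "ttgt A u = fo K True"
  proof -
    have "(False, True) \<in> ar cat_two" by (simp add: cat_two_def)
    then have "u \<in> ar (hom A X T)" "adom (hom A X T) u = fo K False"
      "acod (hom A X T) u = fo K True"
      using is_functorD(1-3)[OF K] unfolding u_def by (simp_all add: cat_two_def)
    then show "u \<in> tmor A" "mdom A (tsrc A u) = X" "mcod A (tsrc A u) = T"
      "tsrc A u = fo K False" "ttgt A u = fo K True"
      by (simp_all add: hom_def)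
  qed

  \<comment> \<open>Naturality along \<open>k\<close>, evaluated at the identity of
    \<open>T\<close>: one side gives \<open>k\<close> after \<open>K\<close>, the other \<phi> at
    \<open>k\<close> itself.\<close>
  have \<phi>o: "fo (\<phi> X Y) k = functor_comp cat_two (hom_functor A (mid A X) k) K"
    if k: "k \<in> mor A" "mdom A k = T" "mcod A k = Y" for k Y
  proof -
    have "functor_comp (hom A T T)
        (Cat_functor cat_two (hom A X T) (hom_functor A (mid A X) k)) (\<phi> X T) =
      functor_comp (hom A T T) (\<phi> X Y) (hom_functor A (mid A T) k)"
      using nat mid_in[OF X] k SX unfolding tensor_two_natural_def Let_def
      by (metis T_def X mdom_mid mcod_mid)
    from arg_cong[OF this, of "\<lambda>H. fo H (mid A T)"]
    have "fo (Cat_functor cat_two (hom A X T) (hom_functor A (mid A X) k)) K =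
      fo (\<phi> X Y) (fo (hom_functor A (mid A T) k) (mid A T))"
      using midT by (simp add: functor_comp_def K_def)
    then show ?thesis
      using Kob midT k T by (simp add: Cat_functor_def hom_functor_def mcod_mid tid_mid_whisker mid_in)
  qed
  have \<phi>u: "fa (fo (\<phi> X Y) k) (False, True) = hcomp A (tid A k) u"
    if k: "k \<in> mor A" "mdom A k = T" "mcod A k = Y" for k Y
    using u k X
    by (simp add: \<phi>o[OF k] functor_comp_def hom_functor_def cat_two_def mcod_mid hom_def
        tid_mid_whisker flip: u_def)
  \<comment> \<open>The same evaluation one dimension higher: naturality at the identity 2-morphism
    in the first variable and \<beta> in the second shows that \<beta> is sent to its whiskerings
    with the two objects picked out by \<open>K\<close>.\<close>
  have \<phi>a: "body (fa (\<phi> X Y) \<beta>) x = hcomp A \<beta> (tid A (fo K x))"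
    if \<beta>: "\<beta> \<in> tmor A" "mdom A (tsrc A \<beta>) = T" "mcod A (tsrc A \<beta>) = Y" for \<beta> Y x
  proof -
    let ?\<alpha> = "tid A (mid A X)"
    have \<alpha>: "?\<alpha> \<in> tmor A" "tsrc A ?\<alpha> = mid A X" "mdom A (mid A X) = X" "mcod A (mid A X) = X"
      using X by (simp_all add: tid_in mid_in tsrc_tid mdom_mid mcod_mid)
    have midT': "tsrc A (tid A (mid A T)) = mid A T" "mcod A (mid A T) = T" "mid A T \<in> mor A"
      "mdom A (mid A T) = T" "tid A (mid A T) \<in> tmor A"
      using T by (simp_all add: tid_in mid_in tsrc_tid mdom_mid mcod_mid)
    have "whisker_nat_functor (hom A T T) (Cat_nat cat_two (hom A X T) (hom_nat A ?\<alpha> \<beta>)) (\<phi> X T) =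
        whisker_functor_nat (hom A T T) (\<phi> X Y) (hom_nat A (tid A (mid A T)) \<beta>)"
      using nat \<alpha> \<beta> SX unfolding tensor_two_natural_def Let_def by (metis T_def)
    from arg_cong[OF this, of "\<lambda>\<tau>. body \<tau> (mid A T)"]
    have "body (Cat_nat cat_two (hom A X T) (hom_nat A ?\<alpha> \<beta>)) K =
        fa (\<phi> X Y) (body (hom_nat A (tid A (mid A T)) \<beta>) (mid A T))"
      using midT by (simp add: whisker_nat_functor_def whisker_functor_nat_def K_def)
    then have "whisker_nat_functor cat_two (hom_nat A ?\<alpha> \<beta>) K =
        fa (\<phi> X Y) (hcomp A \<beta> (hcomp A (tid A (mid A T)) (tid A (mid A T))))"
      using Kob midT \<beta>(2) by (simp add: Cat_nat_def hom_nat_def midT')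
    also have "\<dots> = fa (\<phi> X Y) \<beta>"
      using \<beta> midT' by (simp add: tid_mid_whisker)
    finally have *: "fa (\<phi> X Y) \<beta> = whisker_nat_functor cat_two (hom_nat A ?\<alpha> \<beta>) K" ..
    have Kx: "fo K x \<in> ob (hom A X T)" using is_functorD(4)[OF K] by (simp add: cat_two_def)
    then have "tid A (fo K x) \<in> tmor A" "tsrc A (tid A (fo K x)) = fo K x" "mdom A (fo K x) = X"
      by (auto simp: hom_def tid_in tsrc_tid)
    with Kx show ?thesis
      unfolding * whisker_nat_functor_def using \<beta>(2)
      by (simp add: cat_two_def hom_nat_def \<alpha> tid_mid_whisker)
  qed

  show thesis
  proof
    show "T \<in> obj A" by (fact T)
    show "u \<in> tmor A" "mdom A (tsrc A u) = X" "mcod A (tsrc A u) = T" by (fact u)+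
    show "\<exists>k\<in>mor A. mdom A k = T \<and> mcod A k = mcod A (tsrc A \<theta>) \<and> hcomp A (tid A k) u = \<theta>"
      if \<theta>: "\<theta> \<in> tmor A" "mdom A (tsrc A \<theta>) = X" for \<theta>
    proof -
      define Y where "Y = mcod A (tsrc A \<theta>)"
      have Y: "Y \<in> obj A" using \<theta> by (simp add: Y_def mcod_in tsrc_in)
      have "\<theta> \<in> ar (hom A X Y)" using \<theta> by (simp add: hom_def Y_def)
      then obtain J where "is_functor cat_two (hom A X Y) J" "fa J (False, True) = \<theta>"
        using category.ex_functor_two[OF hom_category[OF X Y]] by blast
      moreover then obtain k where "k \<in> ob (hom A T Y)" "fo (\<phi> X Y) k = J"
        using bo[OF Y] unfolding bij_betw_def functor_cat_def
        by (metis (no_types, lifting) cat.select_convs(1) imageE mem_Collect_eq)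
      ultimately show ?thesis using \<phi>u[of k Y] by (auto simp: hom_def Y_def)
    qed
    show "k = k'" if k: "k \<in> mor A" "k' \<in> mor A" "mdom A k = T" "mdom A k' = T" "mcod A k = mcod A k'"
      "hcomp A (tid A k) u = hcomp A (tid A k') u" for k k'
    proof -
      define Y where "Y = mcod A k"
      have Y: "Y \<in> obj A" using k by (simp add: Y_def mcod_in)
      have kk: "k \<in> ob (hom A T Y)" "k' \<in> ob (hom A T Y)" using k by (simp_all add: hom_def Y_def)
      then have "is_functor cat_two (hom A X Y) (fo (\<phi> X Y) k)"
        "is_functor cat_two (hom A X Y) (fo (\<phi> X Y) k')"
        using bo[OF Y] unfolding bij_betw_def functor_cat_def by auto
      moreover have "fa (fo (\<phi> X Y) k) (False, True) = fa (fo (\<phi> X Y) k') (False, True)"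
        using \<phi>u k Y_def by simp
      ultimately have "fo (\<phi> X Y) k = fo (\<phi> X Y) k'" by (rule functor_two_eqI)
      then show ?thesis using bo[OF Y] kk unfolding bij_betw_def inj_on_def by blast
    qed
    show "\<beta> = \<beta>'" if \<beta>: "\<beta> \<in> tmor A" "\<beta>' \<in> tmor A" "mdom A (tsrc A \<beta>) = T"
      "tsrc A \<beta> = tsrc A \<beta>'" "ttgt A \<beta> = ttgt A \<beta>'"
      "hcomp A \<beta> (tid A (tsrc A u)) = hcomp A \<beta>' (tid A (tsrc A u))"
      "hcomp A \<beta> (tid A (ttgt A u)) = hcomp A \<beta>' (tid A (ttgt A u))" for \<beta> \<beta>'
    proof -
      define Y where "Y = mcod A (tsrc A \<beta>)"
      have Y: "Y \<in> obj A" using \<beta> by (simp add: Y_def mcod_in tsrc_in)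
      have in_ar: "\<beta> \<in> ar (hom A T Y)" "\<beta>' \<in> ar (hom A T Y)"
        using \<beta> by (simp_all add: hom_def Y_def)
      \<comment> \<open>The values of \<open>K\<close> at \<open>False\<close> and
        \<open>True\<close> are the source and target of \<open>u\<close>, so the two whiskering
        hypotheses are exactly the two components.\<close>
      have "body (fa (\<phi> X Y) \<beta>) x = body (fa (\<phi> X Y) \<beta>') x" for x
        using \<phi>a[of \<beta> Y x] \<phi>a[of \<beta>' Y x] \<beta> u by (cases x) (auto simp: Y_def)
      then have "body (fa (\<phi> X Y) \<beta>) = body (fa (\<phi> X Y) \<beta>')" by auto
      moreover have "source (fa (\<phi> X Y) \<gamma>) = fo (\<phi> X Y) (tsrc A \<gamma>)"
        "target (fa (\<phi> X Y) \<gamma>) = fo (\<phi> X Y) (ttgt A \<gamma>)" if "\<gamma> \<in> ar (hom A T Y)" for \<gamma>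
        using is_functorD(2,3)[OF fu[OF Y] that] by (simp_all add: functor_cat_def hom_def)
      ultimately have "fa (\<phi> X Y) \<beta> = fa (\<phi> X Y) \<beta>'"
        using in_ar \<beta> by (simp add: framed.expand)
      then show ?thesis using ba[OF Y] in_ar unfolding bij_betw_def inj_on_def by blast
    qed
  qed
qed

lemma whisker_left_in:
    "\<lbrakk>k \<in> mor A; \<alpha> \<in> tmor A; mdom A k = mcod A (tsrc A \<alpha>)\<rbrakk> \<Longrightarrow> hcomp A (tid A k) \<alpha> \<in> tmor A"
  and tsrc_whisker_left:
    "\<lbrakk>k \<in> mor A; \<alpha> \<in> tmor A; mdom A k = mcod A (tsrc A \<alpha>)\<rbrakk>
      \<Longrightarrow> tsrc A (hcomp A (tid A k) \<alpha>) = mcomp A k (tsrc A \<alpha>)"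
  and ttgt_whisker_left:
    "\<lbrakk>k \<in> mor A; \<alpha> \<in> tmor A; mdom A k = mcod A (tsrc A \<alpha>)\<rbrakk>
      \<Longrightarrow> ttgt A (hcomp A (tid A k) \<alpha>) = mcomp A k (ttgt A \<alpha>)"
  by (simp_all add: hcomp_in tsrc_hcomp ttgt_hcomp tid_in tsrc_tid ttgt_tid)

lemma whisker_left_vcomp:
  "\<lbrakk>k \<in> mor A; \<alpha> \<in> tmor A; \<beta> \<in> tmor A; tsrc A \<beta> = ttgt A \<alpha>; mdom A k = mcod A (tsrc A \<alpha>)\<rbrakk>
    \<Longrightarrow> hcomp A (tid A k) (vcomp A \<beta> \<alpha>) = vcomp A (hcomp A (tid A k) \<beta>) (hcomp A (tid A k) \<alpha>)"
  using interchange[of \<alpha> \<beta> "tid A k" "tid A k"]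
  by (simp add: vcomp_tid_tid tid_in tsrc_tid ttgt_tid)

end


section \<open>2-cones and their modifications, componentwise\<close>

locale two_diagram = A: two_category A + I: two_category I
  for A :: "('o, 'm, 't) two_cat" and I :: "('i, 'j, 'k) two_cat" +
  fixes F :: "('i, 'j, 'k, 'o, 'm, 't) two_fctr"
  assumes F: "is_two_functor I A F"
begin

abbreviation IA where "IA \<equiv> functor_two_cat I A"
abbreviation const where "const \<equiv> const_two_functor I A"
abbreviation cone where "cone \<equiv> is_two_cone I A F"
text \<open>\<open>cone_comp l\<close> and \<open>cone_whisker l\<close> are the object and arrow
  parts of post-composition with \<open>l\<close> after the diagonal. They are also the left-hand
  sides of the two strict-slice conditions, so the same maps govern both notions being
  compared.\<close>

abbreviation cone_comp where "cone_comp l h \<equiv> two_nat_comp I A l (const_two_nat I A h)"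
abbreviation cone_whisker where "cone_whisker l \<theta> \<equiv> hcomp IA (tid IA l) (const_modif I A \<theta>)"

lemma F_simps:
  "i \<in> obj I \<Longrightarrow> F0 F i \<in> obj A"
  "f \<in> mor I \<Longrightarrow> F1 F f \<in> mor A"
  "\<alpha> \<in> tmor I \<Longrightarrow> F2 F \<alpha> \<in> tmor A"
  "f \<in> mor I \<Longrightarrow> mdom A (F1 F f) = F0 F (mdom I f)"
  "f \<in> mor I \<Longrightarrow> mcod A (F1 F f) = F0 F (mcod I f)"
  "\<alpha> \<in> tmor I \<Longrightarrow> tsrc A (F2 F \<alpha>) = F1 F (tsrc I \<alpha>)"
  "\<alpha> \<in> tmor I \<Longrightarrow> ttgt A (F2 F \<alpha>) = F1 F (ttgt I \<alpha>)"
  using F unfolding is_two_functor_def by auto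

lemma const_simps:
  "i \<in> obj I \<Longrightarrow> F0 (const X) i = X"
  "f \<in> mor I \<Longrightarrow> F1 (const X) f = mid A X"
  "\<alpha> \<in> tmor I \<Longrightarrow> F2 (const X) \<alpha> = tid A (mid A X)"
  by (simp_all add: const_two_functor_def)

lemma diag_simps:
  "X \<in> obj A \<Longrightarrow> F0 (diag I A) X = const X"
  "h \<in> mor A \<Longrightarrow> F1 (diag I A) h = const_two_nat I A h"
  "\<theta> \<in> tmor A \<Longrightarrow> F2 (diag I A) \<theta> = const_modif I A \<theta>"
  by (simp_all add: diag_def)

lemmas in_carrier =
  A.mdom_in A.mcod_in A.mid_in A.mdom_mid A.mcod_mid A.mcomp_in A.mdom_mcomp A.mcod_mcomp
  A.tsrc_in A.ttgt_in A.mdom_ttgt A.mcod_ttgt A.tid_in A.tsrc_tid A.ttgt_tid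
  I.mdom_in I.mcod_in I.mid_in I.mdom_mid I.mcod_mid I.mcomp_in I.mdom_mcomp I.mcod_mcomp
  I.tsrc_in I.ttgt_in I.mdom_ttgt I.mcod_ttgt I.tid_in I.tsrc_tid I.ttgt_tid

lemma is_two_functor_const:
  assumes "X \<in> obj A"
  shows "is_two_functor I A (const X)"
  using assms unfolding is_two_functor_def
  by (auto simp: const_two_functor_def in_carrier A.tid_mid_whisker A.vcomp_tid_tid A.hcomp_tid
      I.vcomp_in I.hcomp_in)

text \<open>The constant 2-functor takes only identities as values, so the composites and
  whiskerings on its side of the 2-naturality equations collapse.\<close>

lemma cone_iff:
  "cone X \<mu> \<longleftrightarrow> X \<in> obj A \<and> source \<mu> = const X \<and> target \<mu> = F \<and> body \<mu> \<in> extensional (obj I) \<and>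
    (\<forall>i\<in>obj I. body \<mu> i \<in> mor A \<and> mdom A (body \<mu> i) = X \<and> mcod A (body \<mu> i) = F0 F i) \<and>
    (\<forall>f\<in>mor I. mcomp A (F1 F f) (body \<mu> (mdom I f)) = body \<mu> (mcod I f)) \<and>
    (\<forall>\<alpha>\<in>tmor I. hcomp A (F2 F \<alpha>) (tid A (body \<mu> (mdom I (tsrc I \<alpha>)))) =
      tid A (body \<mu> (mcod I (tsrc I \<alpha>))))" (is "_ \<longleftrightarrow> ?R")
proof -
  have "cone X \<mu> \<longleftrightarrow> X \<in> obj A \<and> is_two_natural I A \<mu> \<and> source \<mu> = const X \<and> target \<mu> = F"
    by (auto simp: is_two_cone_def hom_def functor_two_cat_def diag_simps)
  also have "\<dots> \<longleftrightarrow> ?R"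
    using F is_two_functor_const[of X] unfolding is_two_natural_def
    by (auto simp: PiE_def Pi_iff hom_def const_simps A.tid_mid_whisker in_carrier)
  finally show ?thesis .
qed

lemma coneD:
  assumes "cone X \<mu>"
  shows "X \<in> obj A" "source \<mu> = const X" "target \<mu> = F" "body \<mu> \<in> extensional (obj I)"
    and "i \<in> obj I \<Longrightarrow> body \<mu> i \<in> mor A" "i \<in> obj I \<Longrightarrow> mdom A (body \<mu> i) = X"
      "i \<in> obj I \<Longrightarrow> mcod A (body \<mu> i) = F0 F i"
    and "f \<in> mor I \<Longrightarrow> mcomp A (F1 F f) (body \<mu> (mdom I f)) = body \<mu> (mcod I f)"
    and "\<alpha> \<in> tmor I \<Longrightarrow> hcomp A (F2 F \<alpha>) (tid A (body \<mu> (mdom I (tsrc I \<alpha>)))) =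
      tid A (body \<mu> (mcod I (tsrc I \<alpha>)))"
  using assms unfolding cone_iff by blast+

lemma cone_eqI:
  assumes "cone X \<mu>" "cone X \<nu>" "\<And>i. i \<in> obj I \<Longrightarrow> body \<mu> i = body \<nu> i"
  shows "\<mu> = \<nu>"
  using assms extensionalityI[OF coneD(4)[OF assms(1)] coneD(4)[OF assms(2)]]
  by (intro framed.expand) (auto simp: coneD)

lemma cone_ob: "X \<in> obj A \<Longrightarrow> ob (hom IA (const X) F) = {\<mu>. cone X \<mu>}"
  by (auto simp: is_two_cone_def diag_simps)

lemma cone_modif_iff:
  assumes "X \<in> obj A"
  shows "\<phi> \<in> ar (hom IA (const X) F) \<longleftrightarrow> cone X (source \<phi>) \<and> cone X (target \<phi>) \<and>
    body \<phi> \<in> extensional (obj I) \<and>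
    (\<forall>i\<in>obj I. body \<phi> i \<in> tmor A \<and> tsrc A (body \<phi> i) = body (source \<phi>) i \<and>
      ttgt A (body \<phi> i) = body (target \<phi>) i) \<and>
    (\<forall>f\<in>mor I. hcomp A (tid A (F1 F f)) (body \<phi> (mdom I f)) = body \<phi> (mcod I f))" (is "_ \<longleftrightarrow> ?R")
proof -
  have c: "cone X \<mu> \<longleftrightarrow> is_two_natural I A \<mu> \<and> source \<mu> = const X \<and> target \<mu> = F" for \<mu>
    using assms by (auto simp: is_two_cone_def hom_def functor_two_cat_def diag_simps)
  \<comment> \<open>Membership in \<open>hom\<close> tests only the source of a modification; that
    its target is a 2-cone with the same vertex follows because a modification has parallel source
    and target.\<close>
  have "\<phi> \<in> ar (hom IA (const X) F) \<longleftrightarrow> is_modification I A \<phi> \<and> cone X (source \<phi>)"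
    unfolding c by (auto simp: hom_def functor_two_cat_def is_modification_def)
  also have "\<dots> \<longleftrightarrow> cone X (source \<phi>) \<and> cone X (target \<phi>) \<and> is_modification I A \<phi>"
    unfolding c is_modification_def by metis
  also have "\<dots> \<longleftrightarrow> ?R"
  proof (intro conj_cong refl)
    assume s: "cone X (source \<phi>)" and t: "cone X (target \<phi>)"
    then have "is_two_natural I A (source \<phi>)" "is_two_natural I A (target \<phi>)" by (simp_all add: c)
    moreover have "hcomp A (body \<phi> (mcod I f)) (tid A (mid A X)) = body \<phi> (mcod I f)"
      if "f \<in> mor I" "body \<phi> (mcod I f) \<in> tmor A"
        "tsrc A (body \<phi> (mcod I f)) = body (source \<phi>) (mcod I f)" for f
      using that s by (intro A.tid_mid_whisker) (simp_all add: coneD in_carrier)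
    ultimately show "is_modification I A \<phi> \<longleftrightarrow> body \<phi> \<in> extensional (obj I) \<and>
      (\<forall>i\<in>obj I. body \<phi> i \<in> tmor A \<and> tsrc A (body \<phi> i) = body (source \<phi>) i \<and>
        ttgt A (body \<phi> i) = body (target \<phi>) i) \<and>
      (\<forall>f\<in>mor I. hcomp A (tid A (F1 F f)) (body \<phi> (mdom I f)) = body \<phi> (mcod I f))"
      unfolding is_modification_def coneD(2,3)[OF s] coneD(2,3)[OF t] PiE_def
      by (simp add: const_simps Pi_iff in_carrier) (auto simp: in_carrier)
  qed
  finally show ?thesis .
qed

section \<open>Composing a 2-cone with morphisms and 2-morphisms into its vertex\<close>

lemma cone_comp_body: "i \<in> obj I \<Longrightarrow> body (cone_comp l h) i = mcomp A (body l i) h"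
  by (simp add: two_nat_comp_def const_two_nat_def)

text \<open>Associativity moves \<open>h\<close> outside in both equations, leaving the
  corresponding equation of \<open>l\<close> composed or whiskered with \<open>h\<close>.\<close>

lemma cone_cone_comp:
  assumes l: "cone L l" and h: "h \<in> mor A" "mcod A h = L"
  shows "cone (mdom A h) (cone_comp l h)"
proof -
  have "hcomp A (F2 F \<alpha>) (tid A (mcomp A (body l (mdom I (tsrc I \<alpha>))) h)) =
      tid A (mcomp A (body l (mcod I (tsrc I \<alpha>))) h)" if \<alpha>: "\<alpha> \<in> tmor I" for \<alpha>
  proof -
    let ?i = "mdom I (tsrc I \<alpha>)" and ?j = "mcod I (tsrc I \<alpha>)"
    have *: "?i \<in> obj I" "?j \<in> obj I" using \<alpha> by (simp_all add: in_carrier)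
    have "hcomp A (F2 F \<alpha>) (hcomp A (tid A (body l ?i)) (tid A h)) =
        hcomp A (hcomp A (F2 F \<alpha>) (tid A (body l ?i))) (tid A h)"
      by (rule A.hcomp_assoc[symmetric])
        (use \<alpha> * h in \<open>simp_all add: in_carrier F_simps coneD[OF l]\<close>)
    also have "\<dots> = tid A (mcomp A (body l ?j) h)"
      using \<alpha> * h by (simp add: coneD[OF l] A.hcomp_tid)
    finally show ?thesis using * h by (simp add: coneD[OF l] A.hcomp_tid)
  qed
  moreover have "mcomp A (F1 F f) (mcomp A (body l (mdom I f)) h) = mcomp A (body l (mcod I f)) h"
    if f: "f \<in> mor I" for f
  proof -
    have "mcomp A (F1 F f) (mcomp A (body l (mdom I f)) h) =
        mcomp A (mcomp A (F1 F f) (body l (mdom I f))) h"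
      using f h A.mcomp_assoc[of h "body l (mdom I f)" "F1 F f"]
      by (simp add: in_carrier F_simps coneD[OF l])
    then show ?thesis using coneD(8)[OF l f] by simp
  qed
  ultimately show ?thesis
    using h unfolding cone_iff
    by (simp add: two_nat_comp_def const_two_nat_def in_carrier coneD[OF l])
qed

lemma cone_whisker_eq:
  "cone_whisker l \<theta> = Framed (cone_comp l (tsrc A \<theta>)) (\<lambda>i\<in>obj I. hcomp A (tid A (body l i)) \<theta>)
    (cone_comp l (ttgt A \<theta>))"
  by (auto simp: functor_two_cat_def const_modif_def intro!: restrict_ext)

lemma cone_whisker_in:
  assumes l: "cone L l" and \<theta>: "\<theta> \<in> ar (hom A X L)" and X: "X \<in> obj A"
  shows "cone_whisker l \<theta> \<in> ar (hom IA (const X) F)"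
proof -
  have \<theta>': "\<theta> \<in> tmor A" "mdom A (tsrc A \<theta>) = X" "mcod A (tsrc A \<theta>) = L"
    using \<theta> by (auto simp: hom_def)
  have "hcomp A (tid A (F1 F f)) (hcomp A (tid A (body l (mdom I f))) \<theta>) =
      hcomp A (tid A (body l (mcod I f))) \<theta>" if f: "f \<in> mor I" for f
    using f \<theta>' A.whisker_mcomp_left[of \<theta> "body l (mdom I f)" "F1 F f"]
    by (simp add: in_carrier F_simps coneD[OF l])
  then show ?thesis
    unfolding cone_modif_iff[OF X] cone_whisker_eq
    using \<theta>' cone_cone_comp[OF l, of "tsrc A \<theta>"] cone_cone_comp[OF l, of "ttgt A \<theta>"]
    by (simp add: in_carrier coneD[OF l] A.whisker_left_in A.tsrc_whisker_left A.ttgt_whisker_left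
        cone_comp_body)
qed

text \<open>\<open>postcomp_functor\<close> is \<open>undefined\<close> off its hom-category, so
  evaluating it on the diagonal requires that the diagonal really lands there;
  \<open>const_modif_in\<close> does the same for 2-morphisms.\<close>

lemma const_two_nat_in:
  assumes "h \<in> mor A"
  shows "const_two_nat I A h \<in> ob (hom IA (const (mdom A h)) (const (mcod A h)))"
  using assms unfolding hom_def functor_two_cat_def
  by (auto simp: is_two_natural_def is_two_functor_const const_two_nat_def hom_def const_simps
      A.tid_mid_whisker in_carrier)

lemma const_modif_in:
  assumes "\<theta> \<in> tmor A"
  shows "const_modif I A \<theta> \<in> ar (hom IA (const (mdom A (tsrc A \<theta>))) (const (mcod A (tsrc A \<theta>))))"
proof -
  have n: "is_two_natural I A (const_two_nat I A h)" if "h \<in> mor A" for h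
    using const_two_nat_in[OF that] by (simp add: hom_def functor_two_cat_def)
  show ?thesis
    using assms n[of "tsrc A \<theta>"] n[of "ttgt A \<theta>"] unfolding hom_def functor_two_cat_def
    by (auto simp: is_modification_def const_modif_def const_two_nat_def const_simps
        A.tid_mid_whisker in_carrier)
qed

section \<open>The comparison functor of a 2-cone\<close>

abbreviation comparison where
  "comparison L l X \<equiv> functor_comp (hom A X L) (postcomp_functor IA (F0 (diag I A) X) l)
     (two_functor_on_hom A (diag I A) X L)"

lemma comparison_simps:
  assumes l: "cone L l" and X: "X \<in> obj A"
  shows "h \<in> ob (hom A X L) \<Longrightarrow> fo (comparison L l X) h = cone_comp l h"
    and "\<theta> \<in> ar (hom A X L) \<Longrightarrow> fa (comparison L l X) \<theta> = cone_whisker l \<theta>"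
proof -
  have IA: "mdom IA = source" "mcomp IA = two_nat_comp I A" by (simp_all add: functor_two_cat_def)
  show "fo (comparison L l X) h = cone_comp l h" if "h \<in> ob (hom A X L)"
    using that const_two_nat_in[of h]
    by (simp add: functor_comp_def two_functor_on_hom_def postcomp_functor_def diag_simps X IA
        coneD[OF l]) (simp add: hom_def diag_simps)
  show "fa (comparison L l X) \<theta> = cone_whisker l \<theta>" if "\<theta> \<in> ar (hom A X L)"
    using that const_modif_in[of \<theta>]
    by (simp add: functor_comp_def two_functor_on_hom_def postcomp_functor_def diag_simps X IA
        coneD[OF l]) (simp add: hom_def diag_simps)
qed

text \<open>Preservation of vertical composites is the interchange law with the identity on a leg of
  \<open>l\<close>, as in \<open>whisker_left_vcomp\<close>; preservation of identities is
  \<open>hcomp_tid\<close>.\<close>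

lemma comparison_functor:
  assumes l: "cone L l" and X: "X \<in> obj A"
  shows "is_functor (hom A X L) (hom IA (const X) F) (comparison L l X)"
proof -
  let ?P = "comparison L l X"
  have ob: "ob (hom A X L) = {h \<in> mor A. mdom A h = X \<and> mcod A h = L}"
    and ar: "ar (hom A X L) = {\<theta> \<in> tmor A. mdom A (tsrc A \<theta>) = X \<and> mcod A (tsrc A \<theta>) = L}"
    and ops: "adom (hom A X L) = tsrc A" "acod (hom A X L) = ttgt A" "aid (hom A X L) = tid A"
      "acomp (hom A X L) = vcomp A"
    by (simp_all add: hom_def)
  have IA: "adom (hom IA (const X) F) = source" "acod (hom IA (const X) F) = target"
    "aid (hom IA (const X) F) = (\<lambda>\<mu>. Framed \<mu> (\<lambda>i\<in>obj I. tid A (body \<mu> i)) \<mu>)"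
    "acomp (hom IA (const X) F) =
      (\<lambda>\<psi> \<phi>. Framed (source \<phi>) (\<lambda>i\<in>obj I. vcomp A (body \<psi> i) (body \<phi> i)) (target \<psi>))"
    by (simp_all add: hom_def functor_two_cat_def)
  have "fo ?P \<in> extensional (ob (hom A X L))" "fa ?P \<in> extensional (ar (hom A X L))"
    by (simp_all add: functor_comp_def)
  moreover have "fo ?P h \<in> ob (hom IA (const X) F)" if "h \<in> ob (hom A X L)" for h
    using that cone_cone_comp[OF l, of h] comparison_simps(1)[OF l X that]
    unfolding cone_ob[OF X] ob by auto
  moreover have "fa ?P \<theta> \<in> ar (hom IA (const X) F)" if "\<theta> \<in> ar (hom A X L)" for \<theta>
    using cone_whisker_in[OF l that X] comparison_simps(2)[OF l X that] by simp
  moreover have "source (fa ?P \<theta>) = fo ?P (tsrc A \<theta>)" "target (fa ?P \<theta>) = fo ?P (ttgt A \<theta>)"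
    if "\<theta> \<in> ar (hom A X L)" for \<theta>
    using that comparison_simps(2)[OF l X that] comparison_simps(1)[OF l X, of "tsrc A \<theta>"]
      comparison_simps(1)[OF l X, of "ttgt A \<theta>"]
    by (simp_all add: cone_whisker_eq ob ar in_carrier)
  moreover have "fa ?P (tid A h) = aid (hom IA (const X) F) (fo ?P h)"
    if h: "h \<in> ob (hom A X L)" for h
  proof -
    have h': "h \<in> mor A" "mdom A h = X" "mcod A h = L" using h by (simp_all add: ob)
    then have "tid A h \<in> ar (hom A X L)" by (simp add: ar in_carrier)
    then show ?thesis
      using h' comparison_simps(1)[OF l X h] comparison_simps(2)[OF l X, of "tid A h"]
      by (auto simp: IA cone_whisker_eq in_carrier cone_comp_body A.hcomp_tid coneD[OF l]
          intro!: restrict_ext)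
  qed
  moreover have "fa ?P (vcomp A \<theta>' \<theta>) = acomp (hom IA (const X) F) (fa ?P \<theta>') (fa ?P \<theta>)"
    if \<theta>: "\<theta> \<in> ar (hom A X L)" "\<theta>' \<in> ar (hom A X L)" "tsrc A \<theta>' = ttgt A \<theta>" for \<theta> \<theta>'
  proof -
    have "vcomp A \<theta>' \<theta> \<in> ar (hom A X L)"
      using \<theta> by (simp add: ar A.vcomp_in A.tsrc_vcomp)
    then show ?thesis
      using \<theta> comparison_simps(2)[OF l X]
      by (auto simp: IA cone_whisker_eq ar A.whisker_left_vcomp A.tsrc_vcomp A.ttgt_vcomp
          coneD[OF l] intro!: restrict_ext)
  qed
  ultimately show ?thesis
    unfolding is_functor_def ops IA(1,2) PiE_def Pi_iff by auto
qed

text \<open>The comparison is always a functor, so being an isomorphism amounts to bijectivity on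
  objects and on arrows. On these carriers its restricted maps agree with \<open>cone_comp l\<close>
  and \<open>cone_whisker l\<close>.\<close>

lemma is_two_limit_iff:
  assumes l: "cone L l"
  shows "is_two_limit I A F (L, l) \<longleftrightarrow>
    (\<forall>X\<in>obj A. bij_betw (cone_comp l) (ob (hom A X L)) {\<mu>. cone X \<mu>} \<and>
      bij_betw (cone_whisker l) (ar (hom A X L)) (ar (hom IA (const X) F)))"
proof -
  have "is_cat_iso (hom A X L) (hom IA (F0 (diag I A) X) F) (comparison L l X) \<longleftrightarrow>
      bij_betw (cone_comp l) (ob (hom A X L)) {\<mu>. cone X \<mu>} \<and>
      bij_betw (cone_whisker l) (ar (hom A X L)) (ar (hom IA (const X) F))" if X: "X \<in> obj A" for X
  proof -
    have "is_cat_iso (hom A X L) (hom IA (const X) F) (comparison L l X) \<longleftrightarrow>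
      bij_betw (fo (comparison L l X)) (ob (hom A X L)) (ob (hom IA (const X) F)) \<and>
      bij_betw (fa (comparison L l X)) (ar (hom A X L)) (ar (hom IA (const X) F))"
      using is_cat_iso_bij_betw is_cat_isoI[OF A.hom_category[OF X coneD(1)[OF l]]]
        comparison_functor[OF l X] by blast
    then show ?thesis
      using bij_betw_cong[of _ "fo (comparison L l X)" "cone_comp l", OF comparison_simps(1)[OF l X]]
        bij_betw_cong[of _ "fa (comparison L l X)" "cone_whisker l", OF comparison_simps(2)[OF l X]]
      by (simp only: diag_simps(1)[OF X] cone_ob[OF X])
  qed
  then show ?thesis using l unfolding is_two_limit_def by simp
qed


section \<open>2-terminal objects of the strict-slice\<close>

abbreviation slice where "slice \<equiv> strict_slice I A F"

lemma slice_ob_iff: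
  assumes "cone X \<mu>" "cone L l"
  shows "p \<in> ob (hom slice (X, \<mu>) (L, l)) \<longleftrightarrow>
    (\<exists>h\<in>ob (hom A X L). cone_comp l h = \<mu> \<and> p = Framed (X, \<mu>) h (L, l))"
  using assms
  by (cases p)
    (auto simp: hom_def strict_slice_def is_slice_mor_def functor_two_cat_def diag_simps)

text \<open>Together with \<open>slice_ob_iff\<close>: a hom-category of the strict-slice is the
  fibre of the comparison functor over the object \<mu> and the identity of \<mu>.\<close>

lemma slice_ar_iff:
  assumes "cone X \<mu>" "cone L l"
  shows "a \<in> ar (hom slice (X, \<mu>) (L, l)) \<longleftrightarrow>
    (\<exists>\<theta>\<in>ar (hom A X L). \<exists>p\<in>ob (hom slice (X, \<mu>) (L, l)). \<exists>q\<in>ob (hom slice (X, \<mu>) (L, l)).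
      a = Framed p \<theta> q \<and> tsrc A \<theta> = body p \<and> ttgt A \<theta> = body q \<and> cone_whisker l \<theta> = tid IA \<mu>)"
  using assms
  by (cases a)
    (auto simp: hom_def strict_slice_def is_slice_tmor_def is_slice_mor_def diag_simps Let_def)

text \<open>This is bijectivity of \<open>cone_comp l\<close> on objects. The 2-dimensional
  universal property will come from applying it to 2-cones whose vertex is a tensor.\<close>

lemma two_terminal_factor_ex1:
  assumes "is_two_terminal slice (L, l)" and \<mu>: "cone X \<mu>"
  shows "\<exists>!h. h \<in> ob (hom A X L) \<and> cone_comp l h = \<mu>"
proof -
  have l: "cone L l" using assms by (simp add: is_two_terminal_def strict_slice_def)
  have "cat_isomorphic (hom slice (X, \<mu>) (L, l)) cat_one"
    using assms by (simp add: is_two_terminal_def strict_slice_def)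
  then have "\<exists>!p. p \<in> ob (hom slice (X, \<mu>) (L, l))" by (rule cat_isomorphic_one_ob)
  then show ?thesis unfolding slice_ob_iff[OF \<mu> l] by (metis framed.inject)
qed

lemma tid_IA: "tid IA \<mu> = Framed \<mu> (\<lambda>i\<in>obj I. tid A (body \<mu> i)) \<mu>"
  by (simp add: functor_two_cat_def)

lemma cone_whisker_tid:
  assumes "cone L l" "h \<in> mor A" "mcod A h = L"
  shows "cone_whisker l (tid A h) = tid IA (cone_comp l h)"
  using assms unfolding cone_whisker_eq unfolding tid_IA
  by (auto simp: in_carrier A.hcomp_tid coneD[OF assms(1)] cone_comp_body
      intro!: restrict_ext)

text \<open>Fibres of bijections are singletons. The object fibre is some \<open>{h}\<close>, and
  the fibre over the identity of \<mu> contains the identity of \<open>h\<close>, hence nothing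
  else.\<close>

lemma two_terminal_of_two_limit:
  assumes l: "cone L l" and lim: "is_two_limit I A F (L, l)"
  shows "is_two_terminal slice (L, l)"
proof -
  have "cat_isomorphic (hom slice (X, \<mu>) (L, l)) cat_one" if \<mu>: "cone X \<mu>" for X \<mu>
  proof -
    let ?H = "hom slice (X, \<mu>) (L, l)"
    have X: "X \<in> obj A" using \<mu> by (rule coneD)
    have bo: "bij_betw (cone_comp l) (ob (hom A X L)) {\<mu>. cone X \<mu>}"
      and ba: "bij_betw (cone_whisker l) (ar (hom A X L)) (ar (hom IA (const X) F))"
      using lim X unfolding is_two_limit_iff[OF l] by auto
    have "\<mu> \<in> cone_comp l ` ob (hom A X L)" using bo \<mu> by (simp add: bij_betw_def)
    then obtain h where h: "h \<in> ob (hom A X L)" "cone_comp l h = \<mu>" by auto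
    have h_unique: "g = h" if "g \<in> ob (hom A X L)" "cone_comp l g = \<mu>" for g
      by (rule inj_onD[OF bij_betw_imp_inj_on[OF bo]]) (use h that in simp_all)
    have h': "h \<in> mor A" "mdom A h = X" "mcod A h = L" using h by (simp_all add: hom_def)
    define p where "p = Framed (X, \<mu>) h (L, l)"
    have ob: "ob ?H = {p}"
      using h h_unique unfolding p_def set_eq_iff slice_ob_iff[OF \<mu> l] by blast
    have tid_h: "tid A h \<in> ar (hom A X L)" "cone_whisker l (tid A h) = tid IA \<mu>"
      using h' h cone_whisker_tid[OF l] by (simp_all add: hom_def in_carrier)
    have tid_unique: "\<theta> = tid A h"
      if "\<theta> \<in> ar (hom A X L)" "cone_whisker l \<theta> = tid IA \<mu>" for \<theta>
      by (rule inj_onD[OF bij_betw_imp_inj_on[OF ba]]) (use tid_h that in simp_all)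
    have "tsrc A (tid A h) = body p" "ttgt A (tid A h) = body p"
      using h' by (simp_all add: p_def in_carrier)
    then have ar: "ar ?H = {Framed p (tid A h) p}"
      using tid_h tid_unique unfolding set_eq_iff slice_ar_iff[OF \<mu> l] ob by blast
    show ?thesis
      using h' by (intro cat_isomorphic_oneI[OF ob ar])
        (simp_all add: hom_def strict_slice_def p_def A.vcomp_tid_tid)
  qed
  then show ?thesis using l by (auto simp: is_two_terminal_def strict_slice_def)
qed

lemma two_limit_of_two_terminal:
  assumes tensors: "admits_tensors A cat_two" and ter: "is_two_terminal slice (L, l)"
  shows "is_two_limit I A F (L, l)"
proof -
  have l: "cone L l" using ter by (simp add: is_two_terminal_def strict_slice_def)
  note ex1 = two_terminal_factor_ex1[OF ter]
  have "bij_betw (cone_comp l) (ob (hom A X L)) {\<mu>. cone X \<mu>}" if X: "X \<in> obj A" for X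
  proof (rule bij_betw_imageI)
    have "cone X (cone_comp l h)" if "h \<in> ob (hom A X L)" for h
      using that cone_cone_comp[OF l, of h] by (auto simp: hom_def)
    then show "inj_on (cone_comp l) (ob (hom A X L))" "cone_comp l ` ob (hom A X L) = {\<mu>. cone X \<mu>}"
      using ex1 by (fastforce simp: inj_on_def)+
  qed
  moreover have "bij_betw (cone_whisker l) (ar (hom A X L)) (ar (hom IA (const X) F))"
    if X: "X \<in> obj A" for X
  proof -
    obtain T u where T: "T \<in> obj A" and u: "u \<in> tmor A" "mdom A (tsrc A u) = X" "mcod A (tsrc A u) = T"
      and factor: "\<And>\<theta>. \<lbrakk>\<theta> \<in> tmor A; mdom A (tsrc A \<theta>) = X\<rbrakk> \<Longrightarrow>
        \<exists>k\<in>mor A. mdom A k = T \<and> mcod A k = mcod A (tsrc A \<theta>) \<and> hcomp A (tid A k) u = \<theta>"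
      and unique: "\<And>k k'. \<lbrakk>k \<in> mor A; k' \<in> mor A; mdom A k = T; mdom A k' = T; mcod A k = mcod A k';
        hcomp A (tid A k) u = hcomp A (tid A k') u\<rbrakk> \<Longrightarrow> k = k'"
      and faithful: "\<And>\<beta> \<beta>'. \<lbrakk>\<beta> \<in> tmor A; \<beta>' \<in> tmor A; mdom A (tsrc A \<beta>) = T;
        tsrc A \<beta> = tsrc A \<beta>'; ttgt A \<beta> = ttgt A \<beta>';
        hcomp A \<beta> (tid A (tsrc A u)) = hcomp A \<beta>' (tid A (tsrc A u));
        hcomp A \<beta> (tid A (ttgt A u)) = hcomp A \<beta>' (tid A (ttgt A u))\<rbrakk> \<Longrightarrow> \<beta> = \<beta>'"
      by (rule A.tensor_two_obtain[OF tensors X]) (rule that; assumption)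
    \<comment> \<open>The legs of \<open>m\<close> are the factorizations of the components of
      \<phi> through \<open>u\<close>; the 2-cone equations have to be derived for them.\<close>
    have ex_cone: "\<exists>m. cone T m \<and> (\<forall>i\<in>obj I. hcomp A (tid A (body m i)) u = body \<phi> i)"
      if "\<phi> \<in> ar (hom IA (const X) F)" for \<phi>
    proof -
      have src: "cone X (source \<phi>)" and tgt: "cone X (target \<phi>)"
        and \<phi>: "\<And>i. i \<in> obj I \<Longrightarrow> body \<phi> i \<in> tmor A"
          "\<And>i. i \<in> obj I \<Longrightarrow> tsrc A (body \<phi> i) = body (source \<phi>) i"
          "\<And>i. i \<in> obj I \<Longrightarrow> ttgt A (body \<phi> i) = body (target \<phi>) i"
          "\<And>f. f \<in> mor I \<Longrightarrow> hcomp A (tid A (F1 F f)) (body \<phi> (mdom I f)) = body \<phi> (mcod I f)"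
        using that unfolding cone_modif_iff[OF X] by auto
      have "\<exists>k\<in>mor A. mdom A k = T \<and> mcod A k = F0 F i \<and> hcomp A (tid A k) u = body \<phi> i"
        if "i \<in> obj I" for i
        using factor[of "body \<phi> i"] \<phi>(1,2)[OF that] coneD(6,7)[OF src that] by simp
      then obtain k where k: "\<And>i. i \<in> obj I \<Longrightarrow> k i \<in> mor A" "\<And>i. i \<in> obj I \<Longrightarrow> mdom A (k i) = T"
        "\<And>i. i \<in> obj I \<Longrightarrow> mcod A (k i) = F0 F i" "\<And>i. i \<in> obj I \<Longrightarrow> hcomp A (tid A (k i)) u = body \<phi> i"
        by metis
      \<comment> \<open>Composing the legs with the source and target of \<open>u\<close> recovers
        the source and target 2-cones of \<phi>.\<close>
      have k_src: "mcomp A (k i) (tsrc A u) = body (source \<phi>) i"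
        and k_tgt: "mcomp A (k i) (ttgt A u) = body (target \<phi>) i" if "i \<in> obj I" for i
        using A.tsrc_whisker_left[of "k i" u] A.ttgt_whisker_left[of "k i" u] k \<phi> u that by simp_all
      define m where "m = Framed (const T) (\<lambda>i\<in>obj I. k i) F"
      have "mcomp A (F1 F f) (k (mdom I f)) = k (mcod I f)" if f: "f \<in> mor I" for f
      \<comment> \<open>After whiskering with \<open>u\<close>, the equation becomes the
        modification axiom for \<phi> at \<open>f\<close>.\<close>
      proof (rule unique)
        show "hcomp A (tid A (mcomp A (F1 F f) (k (mdom I f)))) u = hcomp A (tid A (k (mcod I f))) u"
          using f k u \<phi> A.whisker_mcomp_left[of u "k (mdom I f)" "F1 F f"]
          by (simp add: in_carrier F_simps)
      qed (use f k in \<open>simp_all add: in_carrier F_simps\<close>)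
      moreover have "hcomp A (F2 F \<alpha>) (tid A (k (mdom I (tsrc I \<alpha>)))) = tid A (k (mcod I (tsrc I \<alpha>)))"
        if \<alpha>: "\<alpha> \<in> tmor I" for \<alpha>
      proof -
        let ?i = "mdom I (tsrc I \<alpha>)" and ?j = "mcod I (tsrc I \<alpha>)"
        have ij: "?i \<in> obj I" "?j \<in> obj I" using \<alpha> by (simp_all add: in_carrier)
        \<comment> \<open>Joint faithfulness compares only parallel 2-morphisms. The 1-dimensional
          cone equation just proved, at the source and the target of \<alpha>, makes both sides
          2-morphisms from \<open>k ?j\<close> to itself.\<close>
        have 1: "mcomp A (F1 F (tsrc I \<alpha>)) (k ?i) = k ?j" "mcomp A (F1 F (ttgt I \<alpha>)) (k ?i) = k ?j"
          using calculation[of "tsrc I \<alpha>"] calculation[of "ttgt I \<alpha>"] \<alpha> by (simp_all add: in_carrier)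
        \<comment> \<open>Here \<open>d\<close> stands for the source or the target of
          \<open>u\<close>. By \<open>kd\<close> the legs composed with \<open>d\<close> form an
          actual 2-cone \<mu>, whose own 2-dimensional equation at \<alpha> gives the claim.\<close>
        have whisker: "hcomp A (hcomp A (F2 F \<alpha>) (tid A (k ?i))) (tid A d) = hcomp A (tid A (k ?j)) (tid A d)"
          if d: "d \<in> mor A" "mcod A d = T" and \<mu>: "cone X \<mu>"
            and kd: "\<And>i. i \<in> obj I \<Longrightarrow> mcomp A (k i) d = body \<mu> i" for d \<mu>
        proof -
          have "hcomp A (hcomp A (F2 F \<alpha>) (tid A (k ?i))) (tid A d) =
              hcomp A (F2 F \<alpha>) (hcomp A (tid A (k ?i)) (tid A d))"
            by (rule A.hcomp_assoc) (use \<alpha> ij d k in \<open>simp_all add: in_carrier F_simps\<close>)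
          also have "\<dots> = tid A (body \<mu> ?j)"
            using coneD(9)[OF \<mu> \<alpha>] ij d k kd by (simp add: A.hcomp_tid)
          finally show ?thesis using ij d k kd by (simp add: A.hcomp_tid)
        qed
        show ?thesis
        proof (rule faithful)
          show "hcomp A (hcomp A (F2 F \<alpha>) (tid A (k ?i))) (tid A (tsrc A u)) =
              hcomp A (tid A (k ?j)) (tid A (tsrc A u))"
            by (rule whisker[OF _ _ src]) (use u k_src in \<open>simp_all add: in_carrier\<close>)
          show "hcomp A (hcomp A (F2 F \<alpha>) (tid A (k ?i))) (tid A (ttgt A u)) =
              hcomp A (tid A (k ?j)) (tid A (ttgt A u))"
            by (rule whisker[OF _ _ tgt]) (use u k_tgt in \<open>simp_all add: in_carrier\<close>)
        qed (use \<alpha> ij k 1 in \<open>simp_all add: in_carrier F_simps A.hcomp_in A.tsrc_hcomp A.ttgt_hcomp\<close>)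
      qed
      ultimately have "cone T m" unfolding cone_iff m_def using T k by (simp add: in_carrier)
      then show ?thesis using k by (auto simp: m_def)
    qed
    show ?thesis
    proof (rule bij_betw_imageI)
      show "inj_on (cone_whisker l) (ar (hom A X L))"
      proof (rule inj_onI)
        fix \<theta> \<theta>' assume \<theta>: "\<theta> \<in> ar (hom A X L)" "\<theta>' \<in> ar (hom A X L)"
          and eq: "cone_whisker l \<theta> = cone_whisker l \<theta>'"
        have \<theta>A: "\<theta> \<in> tmor A" "mdom A (tsrc A \<theta>) = X" "mcod A (tsrc A \<theta>) = L"
          "\<theta>' \<in> tmor A" "mdom A (tsrc A \<theta>') = X" "mcod A (tsrc A \<theta>') = L"
          using \<theta> by (simp_all add: hom_def)
        \<comment> \<open>Injectivity moves to 1-morphisms: \<open>h\<close> and \<open>h'\<close>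
          are the factorizations of \<theta> and \<theta>' through \<open>u\<close>. Equal
          whiskerings force equal composites with each leg of \<open>l\<close>, and uniqueness of
          factorizations of a 2-cone with vertex \<open>T\<close> gives
          \<open>h = h'\<close>.\<close>
        obtain h where h: "h \<in> mor A" "mdom A h = T" "mcod A h = L" "hcomp A (tid A h) u = \<theta>"
          using factor[of \<theta>] \<theta>A by auto
        obtain h' where h': "h' \<in> mor A" "mdom A h' = T" "mcod A h' = L" "hcomp A (tid A h') u = \<theta>'"
          using factor[of \<theta>'] \<theta>A by auto
        have "hcomp A (tid A (body l i)) \<theta> = hcomp A (tid A (body l i)) \<theta>'" if "i \<in> obj I" for i
          using arg_cong[OF eq, of "\<lambda>\<phi>. body \<phi> i"] that by (simp add: cone_whisker_eq)
        then have "mcomp A (body l i) h = mcomp A (body l i) h'" if "i \<in> obj I" for i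
          using h h' u that A.whisker_mcomp_left[of u _ "body l i"]
          by (intro unique) (simp_all add: in_carrier coneD[OF l])
        then have "cone_comp l h = cone_comp l h'"
          using cone_cone_comp[OF l, of h] cone_cone_comp[OF l, of h'] h h'
          by (intro cone_eqI[of T]) (simp_all add: cone_comp_body)
        then have "h = h'"
          using ex1[of T "cone_comp l h"] cone_cone_comp[OF l, of h] h h' by (auto simp: hom_def)
        then show "\<theta> = \<theta>'" using h h' by simp
      qed
      have "\<phi> \<in> cone_whisker l ` ar (hom A X L)" if \<phi>: "\<phi> \<in> ar (hom IA (const X) F)" for \<phi>
      proof -
        obtain m where m: "cone T m" "\<And>i. i \<in> obj I \<Longrightarrow> hcomp A (tid A (body m i)) u = body \<phi> i"
          using ex_cone[OF \<phi>] by blast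
        obtain h where h: "h \<in> ob (hom A T L)" "cone_comp l h = m" using ex1[OF m(1)] by blast
        then have hA: "h \<in> mor A" "mdom A h = T" "mcod A h = L" by (simp_all add: hom_def)
        \<comment> \<open>Since \<open>h\<close> carries \<open>l\<close> to \<open>m\<close>,
          whiskering \<open>u\<close> by \<open>h\<close> and then by a leg of \<open>l\<close> is
          whiskering \<open>u\<close> by a leg of \<open>m\<close>, which is a component of
          \<phi>.\<close>
        define \<theta> where "\<theta> = hcomp A (tid A h) u"
        have \<theta>: "\<theta> \<in> ar (hom A X L)"
          using u hA unfolding \<theta>_def hom_def
          by (simp add: A.whisker_left_in A.tsrc_whisker_left in_carrier)
        have body: "body (cone_whisker l \<theta>) i = body \<phi> i" if i: "i \<in> obj I" for i
          using A.whisker_mcomp_left[of u h "body l i"] u hA i m(2)[OF i] cone_comp_body[OF i, of l h] h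
          by (simp add: cone_whisker_eq \<theta>_def coneD[OF l])
        have "cone_whisker l \<theta> \<in> ar (hom IA (const X) F)" by (rule cone_whisker_in[OF l \<theta> X])
        \<comment> \<open>Equal components suffice: their sources and targets are the legs of the
          bounding 2-cones, which therefore agree as well.\<close>
        with \<phi> body have "cone_whisker l \<theta> = \<phi>"
          unfolding cone_modif_iff[OF X]
          by (intro framed.expand conjI cone_eqI[of X] extensionalityI[of _ "obj I"]) metis+
        then show ?thesis using \<theta> by blast
      qed
      then show "cone_whisker l ` ar (hom A X L) = ar (hom IA (const X) F)"
        using cone_whisker_in[OF l _ X] by blast
    qed
  qed
  ultimately show ?thesis unfolding is_two_limit_iff[OF l] by blast
qed

end

theorem proposition2p13:
  fixes A :: "('o, 'm, 't) two_cat"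
    and I :: "('i, 'j, 'k) two_cat"
    and F :: "('i, 'j, 'k, 'o, 'm, 't) two_fctr"
    and L :: 'o
    and l :: "('i, 'j, 'k, 'o, 'm, 't) two_ntrans"
  assumes "two_category A"
    and "admits_tensors A cat_two"
    and "two_category I"
    and "is_two_functor I A F"
    and "(L, l) \<in> obj (strict_slice I A F)"
  shows "is_two_terminal (strict_slice I A F) (L, l) \<longleftrightarrow> is_two_limit I A F (L, l)"
proof -
  interpret A: two_category A by fact
  interpret I: two_category I by fact
  interpret two_diagram A I F by unfold_locales fact
  have "cone L l" using assms(5) by (simp add: strict_slice_def)
  then show ?thesis
    using two_terminal_of_two_limit two_limit_of_two_terminal[OF assms(2)] by blast
qed

end
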